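(* Let $d\geq 4$, let $X_d\subset\mathbb{P}^3$ be a smooth surface of degree $d$ that contains a line $\ell=V(x_3,x_4)$, and let $I(X_d)=\langle f\rangle$. The following conditions are equivalent: (a) $\ell$ is a line of the second kind; (b) the function $\mathfrak{b}_0(f)$ vanishes along the line $\ell$ (i.e. $\mathfrak{b}_0(f)$ is identically zero).
   Context: The base field $K$ is algebraically closed of characteristic zero, and $(x_1:x_2:x_3:x_4)$ are homogeneous coordinates on $\mathbb{P}^3$. Line of the second kind: the linear system $|\mathcal{O}_{X_d}(1)-\ell|$ defines a morphism $\pi:X_d\to\mathbb{P}^1$ whose fibers are the plane curves of degree $d-1$ residual to $\ell$ in the intersections of $X_d$ with the planes containing $\ell$. The line $\ell$ is of the second kind if it is contained in the closure of the flex locus of the smooth fibers of $\pi$ (the set of points that are inflection points of a smooth fiber, viewed as a plane curve); otherwise $\ell$ is of the first kind. The function $\mathfrak{b}_0$: write $f=\sum_{i,j,k,l}\alpha_{i,j,k,l}\,x_3^i x_4^j x_1^k x_2^l$ with $\alpha_{i,j,k,l}\in K$, zero unless $i+j+k+l=d$. For $j=1,\dots,4$ put $$\mathfrak{d}_j(f):=\frac{\partial^2 f}{\partial x_j\partial x_3}\cdot\frac{\partial f}{\partial x_4}-\frac{\partial^2 f}{\partial x_j\partial x_4}\cdot\frac{\partial f}{\partial x_3}.$$ For a smooth surface containing $\ell$, neither $\partial f/\partial x_4$ nor $\mathfrak{d}_2(f)$ vanishes identically on $\ell$, so one may define the following rational functions on $\ell$: $$A:=-\frac{\mathfrak{d}_1(f)}{\mathfrak{d}_2(f)}\Big|_\ell,\quad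 B:=\frac{(\partial f/\partial x_3)\,\mathfrak{d}_4(f)-(\partial f/\partial x_4)\,\mathfrak{d}_3(f)}{2\,\mathfrak{d}_2(f)\,(\partial f/\partial x_4)}\Big|_\ell,\quad C:=-\frac{\partial f/\partial x_3}{\partial f/\partial x_4}\Big|_\ell .$$ Then $\mathfrak{b}_0=\mathfrak{b}_0(f)\in K(x_1,x_2)$ is $$\mathfrak{b}_0:=\sum_{\substack{j_1,j_2,j_3\geq 0\\ j_1+j_2\leq 3\\ j_3\leq d-3}}\binom{d-(j_1+j_2+j_3)}{3-(j_1+j_2)}\,\alpha_{j_1,j_2,j_3,d-(j_1+j_2+j_3)}\,A^{d-3-j_3}\,B^{3-(j_1+j_2)}\,C^{j_2}.$$ *)

theory Defs
  imports
    "HOL-Analysis.Analysis"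
    "HOL-Library.Poly_Mapping"
    "HOL-Computational_Algebra.Computational_Algebra"
begin

section \<open>Polynomials in the variables indexed by a finite type\<close>

text \<open>
  A polynomial maps exponent vectors to coefficients; its ring structure is the convolution product
  of \<^theory>\<open>HOL-Library.Poly_Mapping\<close>.  The variables of \<open>K[x\<^sub>1,\<dots>,x\<^sub>n]\<close> are indexed by the
  numeral type \<open>n\<close>, whose elements are written \<open>1, \<dots>, n\<close> (with \<open>n = 0\<close>), as for the
  components of vectors of type \<open>'a ^ n\<close>.
\<close>

type_synonym ('a, 'n) mvpoly = "('n \<Rightarrow>\<^sub>0 nat) \<Rightarrow>\<^sub>0 'a"

definition Const :: "'a::zero \<Rightarrow> ('a, 'n) mvpoly" where
  "Const c = Poly_Mapping.single 0 c"

definition Var :: "'n \<Rightarrow> ('a::zero_neq_one, 'n) mvpoly" where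
  "Var i = Poly_Mapping.single (Poly_Mapping.single i 1) 1"

text \<open>
  Replace every coefficient \<open>c\<close> by \<open>h c\<close> and every variable \<open>x\<^sub>i\<close> by \<open>v i\<close>.
\<close>

definition subst :: "('a::zero \<Rightarrow> 'b::comm_semiring_1) \<Rightarrow> ('n \<Rightarrow> 'b) \<Rightarrow> ('a, 'n::finite) mvpoly \<Rightarrow> 'b" where
  "subst h v p = (\<Sum>m\<in>Poly_Mapping.keys p.
     h (Poly_Mapping.lookup p m) * (\<Prod>i\<in>UNIV. v i ^ Poly_Mapping.lookup m i))"

definition eval :: "'a::comm_semiring_1 ^ 'n \<Rightarrow> ('a, 'n::finite) mvpoly \<Rightarrow> 'a" where
  "eval x = subst (\<lambda>c. c) (\<lambda>i. x $ i)"

definition pd :: "'n \<Rightarrow> ('a::comm_semiring_1, 'n) mvpoly \<Rightarrow> ('a, 'n) mvpoly" where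
  "pd i p = (\<Sum>m\<in>Poly_Mapping.keys p.
     Poly_Mapping.single (m - Poly_Mapping.single i 1)
       (of_nat (Poly_Mapping.lookup m i) * Poly_Mapping.lookup p m))"

definition homogeneous :: "nat \<Rightarrow> ('a::zero, 'n::finite) mvpoly \<Rightarrow> bool" where
  "homogeneous e p \<longleftrightarrow>
     (\<forall>m\<in>Poly_Mapping.keys p. (\<Sum>i\<in>UNIV. Poly_Mapping.lookup m i) = e)"


section \<open>Projective zero sets\<close>

text \<open>
  A subset of projective space is represented by the set of all homogeneous coordinate vectors of
  its points, i.e. by a set of nonzero vectors closed under nonzero scaling.
\<close>

definition proj_zeros :: "('a::comm_semiring_1, 'n::finite) mvpoly \<Rightarrow> ('a ^ 'n) set" where
  "proj_zeros g = {p. p \<noteq> 0 \<and> eval p g = 0}"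

text \<open>
  Over an infinite field a polynomial vanishes at all coordinate vectors of a point if and only if
  each of its homogeneous components does, so for the (nonempty) cones above this is the usual
  homogeneous ideal.
\<close>

definition vanishing_ideal :: "('a::comm_semiring_1 ^ 'n::finite) set \<Rightarrow> ('a, 'n) mvpoly set" where
  "vanishing_ideal X = {g. \<forall>p\<in>X. eval p g = 0}"

definition proj_closure :: "('a::comm_semiring_1 ^ 'n::finite) set \<Rightarrow> ('a ^ 'n) set" where
  "proj_closure S = {p. p \<noteq> 0 \<and>
     (\<forall>e g. homogeneous e g \<longrightarrow> (\<forall>q\<in>S. eval q g = 0) \<longrightarrow> eval p g = 0)}"

text \<open>
  Jacobian criterion for the hypersurface \<open>g = 0\<close>, with its scheme structure.
\<close>

definition smooth :: "('a::comm_semiring_1, 'n::finite) mvpoly \<Rightarrow> bool" where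
  "smooth g \<longleftrightarrow> (\<forall>p\<in>proj_zeros g. \<exists>i. eval p (pd i g) \<noteq> 0)"


section \<open>Lines of the second kind\<close>

text \<open>
  \<open>P\<close> is an inflection point of the plane curve \<open>g = 0\<close>, assumed smooth at \<open>P\<close>, if the tangent line
  at \<open>P\<close> meets the curve at \<open>P\<close> with multiplicity at least 3.  The tangent line is spanned by \<open>P\<close>
  and a second point \<open>Q\<close> on it; the intersection multiplicity is the order of vanishing at
  \<open>t = 0\<close> of \<open>g (P + t Q)\<close>.
\<close>

definition inflection_point :: "('a::field, 3) mvpoly \<Rightarrow> 'a ^ 3 \<Rightarrow> bool" where
  "inflection_point g P \<longleftrightarrow> P \<in> proj_zeros g \<and>
     (\<exists>Q. (\<forall>c. Q \<noteq> c *s P) \<and> (\<Sum>i\<in>UNIV. eval P (pd i g) * Q $ i) = 0 \<and>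
          [:0, 1:] ^ 3 dvd subst (\<lambda>c. [:c:]) (\<lambda>i. [:P $ i, Q $ i:]) g)"

definition line_l :: "('a::zero ^ 4) set" where
  "line_l = {p. p \<noteq> 0 \<and> p $ 3 = 0 \<and> p $ 4 = 0}"

text \<open>
  For \<open>(s, t) \<noteq> (0, 0)\<close> the map \<open>(y\<^sub>1 : y\<^sub>2 : y\<^sub>3) \<mapsto> (y\<^sub>1 : y\<^sub>2 : s y\<^sub>3 : t y\<^sub>3)\<close> identifies the projective
  plane with the plane \<open>t x\<^sub>3 = s x\<^sub>4\<close> containing the line, which is given by \<open>y\<^sub>3 = 0\<close> in these
  coordinates.
\<close>

definition plane_point :: "'a::comm_semiring_1 \<Rightarrow> 'a \<Rightarrow> 'a ^ 3 \<Rightarrow> 'a ^ 4" where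
  "plane_point s t y = vector [y $ 1, y $ 2, s * y $ 3, t * y $ 3]"

definition plane_section :: "('a::comm_semiring_1, 4) mvpoly \<Rightarrow> 'a \<Rightarrow> 'a \<Rightarrow> ('a, 3) mvpoly" where
  "plane_section f s t =
     subst Const
       (\<lambda>i. (vector [Var 1, Var 2, Const s * Var 3, Const t * Var 3] :: ('a, 3) mvpoly ^ 4) $ i) f"

text \<open>
  \<open>g\<close> is the equation of the fibre over \<open>(s : t)\<close>: the curve residual to the line in the plane section.
\<close>

definition residual_curve ::
    "('a::comm_semiring_1, 4) mvpoly \<Rightarrow> 'a \<Rightarrow> 'a \<Rightarrow> ('a, 3) mvpoly \<Rightarrow> bool" where
  "residual_curve f s t g \<longleftrightarrow> plane_section f s t = Var 3 * g"

definition flex_locus :: "('a::field, 4) mvpoly \<Rightarrow> ('a ^ 4) set" where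
  "flex_locus f = {plane_point s t P | s t g P.
     (s, t) \<noteq> (0, 0) \<and> residual_curve f s t g \<and> smooth g \<and> inflection_point g P}"

definition second_kind :: "('a::field, 4) mvpoly \<Rightarrow> bool" where
  "second_kind f \<longleftrightarrow> line_l \<subseteq> proj_closure (flex_locus f)"


section \<open>The function \<open>\<bb>\<^sub>0\<close>\<close>

definition alpha :: "('a::zero, 4) mvpoly \<Rightarrow> nat \<Rightarrow> nat \<Rightarrow> nat \<Rightarrow> nat \<Rightarrow> 'a" where
  "alpha f i j k l = Poly_Mapping.lookup f
     (Poly_Mapping.single 3 i + Poly_Mapping.single 4 j +
      Poly_Mapping.single 1 k + Poly_Mapping.single 2 l)"

definition dd :: "4 \<Rightarrow> ('a::comm_ring_1, 4) mvpoly \<Rightarrow> ('a, 4) mvpoly" where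
  "dd j f = pd j (pd 3 f) * pd 4 f - pd j (pd 4 f) * pd 3 f"

text \<open>
  Restriction to the line (\<open>x\<^sub>3 = x\<^sub>4 = 0\<close>), with values in the rational function field \<open>K(x\<^sub>1, x\<^sub>2)\<close>.
\<close>

definition restrict_l :: "('a::idom, 4) mvpoly \<Rightarrow> ('a, 2) mvpoly fract" where
  "restrict_l g =
     to_fract (subst Const (\<lambda>i. (vector [Var 1, Var 2, 0, 0] :: ('a, 2) mvpoly ^ 4) $ i) g)"

definition fA :: "('a::idom, 4) mvpoly \<Rightarrow> ('a, 2) mvpoly fract" where
  "fA f = - (restrict_l (dd 1 f) / restrict_l (dd 2 f))"

definition fB :: "('a::idom, 4) mvpoly \<Rightarrow> ('a, 2) mvpoly fract" where
  "fB f = restrict_l (pd 3 f * dd 4 f - pd 4 f * dd 3 f) / restrict_l (2 * dd 2 f * pd 4 f)"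

definition fC :: "('a::idom, 4) mvpoly \<Rightarrow> ('a, 2) mvpoly fract" where
  "fC f = - (restrict_l (pd 3 f) / restrict_l (pd 4 f))"

definition b0 :: "nat \<Rightarrow> ('a::idom, 4) mvpoly \<Rightarrow> ('a, 2) mvpoly fract" where
  "b0 d f = (\<Sum>(j1, j2, j3)\<in>{(j1, j2, j3). j1 + j2 \<le> 3 \<and> j3 \<le> d - 3}.
     of_nat ((d - (j1 + j2 + j3)) choose (3 - (j1 + j2))) *
     to_fract (Const (alpha f j1 j2 j3 (d - (j1 + j2 + j3)))) *
     fA f ^ (d - 3 - j3) * fB f ^ (3 - (j1 + j2)) * fC f ^ j2)"

end

theory Submission
  imports Defs
begin

text \<open>
  Write \<open>f = x\<^sub>3 p + x\<^sub>4 q\<close>.  The fibre over \<open>(s : t)\<close> is \<open>F = s p + t q\<close> on the plane with coordinates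
  \<open>(y\<^sub>1 : y\<^sub>2 : s y\<^sub>3 : t y\<^sub>3)\<close>, and \<open>R = (0, F\<^sub>3, -F\<^sub>2)\<close> is a tangent direction of it.  Since \<open>(s : t) = (q : -p)\<close>
  on the surface, substituting \<open>q\<close> and \<open>-p\<close> for \<open>s\<close> and \<open>t\<close> turns the second derivative of \<open>F\<close> along \<open>R\<close>
  into a form \<open>G\<close> in \<open>x\<^sub>1, \<dots>, x\<^sub>4\<close> that vanishes at the flexes of all fibres.  On the line, \<open>A = x\<^sub>2 / x\<^sub>1\<close> by
  Euler's formula and \<open>(0 : B : 1)\<close> is proportional to \<open>R\<close>, so that \<open>b\<^sub>0\<close> is \<open>G\<close> up to a nonzero factor.
  If the line is of the second kind, \<open>G\<close> therefore vanishes on it.  Conversely, if \<open>G\<close> vanishes on the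
  line, all but finitely many of its points are flexes of their fibres, and these fibres are smooth
  by generic smoothness in characteristic zero.
\<close>

text \<open>On the line, everything depends on the Wronskian \<open>q * pd 2 p - p * pd 2 q\<close>.
  It is the restriction of \<open>dd 2 f\<close>, hence the denominator of A, and it is F_2 for the
  parameters (q, -p). Where it is nonzero, R is not proportional to the point of the line and
  therefore spans the tangent with it. It is not identically zero because (p:q) is a nonconstant map
  on the line: p and q have positive degree and, by smoothness, no common zero there. R is the
  tangent vector with first coordinate 0; this choice matches the argument (u, A u + B v, v, C v)
  behind b_0, whose v-direction has no x_1-component. The obstacle is generic smoothness.
  Elimination is avoided: a sequence of singular fibres becomes one singular fibre over an
  ultrapower of K, where its parameter can be differentiated. This only needs derivations that
  extend to finitely many further elements. Restrictions to the line are studied as univariate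
  polynomials in x_2 with x_1 = 1; homogeneity recovers the missing point (0:1:0:0).\<close>

no_notation fps_nth (infixl "$" 75)

section \<open>Calculus of multivariate polynomials\<close>

lemma poly_mapping_conv_sum_single:
  "p = (\<Sum>m\<in>Poly_Mapping.keys p. Poly_Mapping.single m (Poly_Mapping.lookup p m))"
proof (rule poly_mapping_eqI)
  fix k
  show "Poly_Mapping.lookup p k =
      Poly_Mapping.lookup (\<Sum>m\<in>Poly_Mapping.keys p. Poly_Mapping.single m (Poly_Mapping.lookup p m)) k"
    by (simp add: lookup_sum lookup_single when_def in_keys_iff)
qed

lemma poly_mapping_add_induct [case_names zero single add]:
  fixes p :: "'k \<Rightarrow>\<^sub>0 'b::comm_monoid_add"
  assumes "P 0" "\<And>m c. P (Poly_Mapping.single m c)" "\<And>p q. P p \<Longrightarrow> P q \<Longrightarrow> P (p + q)"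
  shows "P p"
proof -
  have "finite S \<Longrightarrow> P (\<Sum>m\<in>S. Poly_Mapping.single m (Poly_Mapping.lookup p m))" for S
    by (induction S rule: finite_induct) (auto intro: assms)
  from this[OF finite_keys] show ?thesis
    using poly_mapping_conv_sum_single[of p] by metis
qed

lemma poly_mapping_conv_sum_UNIV:
  fixes m :: "'n::finite \<Rightarrow>\<^sub>0 'b::comm_monoid_add"
  shows "m = (\<Sum>i\<in>UNIV. Poly_Mapping.single i (Poly_Mapping.lookup m i))"
  by (rule poly_mapping_eqI) (simp add: lookup_sum lookup_single when_def)

lemma Var_power: "Var i ^ k = Poly_Mapping.single (Poly_Mapping.single i k) (1::'a::comm_semiring_1)"
  by (induction k) (auto simp: Var_def mult_single simp flip: single_add)

lemma single_conv_prod_Var: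
  fixes m :: "'n::finite \<Rightarrow>\<^sub>0 nat" and c :: "'a::comm_semiring_1"
  shows "Poly_Mapping.single m c = Const c * (\<Prod>i\<in>UNIV. Var i ^ Poly_Mapping.lookup m i)"
proof -
  have "(\<Prod>i\<in>S. Var i ^ Poly_Mapping.lookup m i) =
     Poly_Mapping.single (\<Sum>i\<in>S. Poly_Mapping.single i (Poly_Mapping.lookup m i)) (1::'a)" if "finite S" for S
    using that by (induction S rule: finite_induct) (auto simp: Var_power mult_single)
  from this[of UNIV] show ?thesis
    by (simp add: Const_def mult_single flip: poly_mapping_conv_sum_UNIV)
qed

text \<open>Ring homomorphisms and derivations are determined by constants and variables, so their
  identities need checking only there.\<close>

lemma mvpoly_induct [case_names Const Var add mult]:
  fixes p :: "('a::comm_semiring_1, 'n::finite) mvpoly"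
  assumes C: "\<And>c. P (Const c)" and V: "\<And>i. P (Var i)"
    and A: "\<And>p q. P p \<Longrightarrow> P q \<Longrightarrow> P (p + q)" and M: "\<And>p q. P p \<Longrightarrow> P q \<Longrightarrow> P (p * q)"
  shows "P p"
proof (induction p rule: poly_mapping_add_induct)
  case zero
  show ?case using C[of 0] by (simp add: Const_def)
next
  case (single m c)
  have 1: "P 1" using C[of 1] by (simp add: Const_def)
  have pow: "P (Var i ^ k)" for i k by (induction k) (auto intro: 1 V M)
  have "finite S \<Longrightarrow> P (\<Prod>i\<in>S. Var i ^ Poly_Mapping.lookup m i)" for S
    by (induction S rule: finite_induct) (auto intro: 1 pow M)
  then show ?case unfolding single_conv_prod_Var by (intro M C) auto
qed (rule A)

lemma Const_0 [simp]: "Const 0 = 0" and Const_1 [simp]: "Const 1 = 1"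
  by (simp_all add: Const_def)

lemma Const_add: "Const (a + b) = Const a + Const b"
  and Const_mult: "Const (a * b) = Const a * Const b"
  by (simp_all add: Const_def single_add mult_single)

section \<open>Substitution as a ring homomorphism, for an arbitrary map of coefficients\<close>

locale coeff_hom =
  fixes h :: "'a::comm_semiring_1 \<Rightarrow> 'b::comm_semiring_1"
  assumes hom_0 [simp]: "h 0 = 0" and hom_1 [simp]: "h 1 = 1"
    and hom_add: "h (a + b) = h a + h b" and hom_mult: "h (a * b) = h a * h b"
begin

context
  fixes v :: "'n::finite \<Rightarrow> 'b"
begin

lemma subst_superset:
  assumes "finite S" "Poly_Mapping.keys p \<subseteq> S"
  shows "subst h v p = (\<Sum>m\<in>S. h (Poly_Mapping.lookup p m) * (\<Prod>i\<in>UNIV. v i ^ Poly_Mapping.lookup m i))"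
  unfolding subst_def using assms by (intro sum.mono_neutral_left) (auto simp: in_keys_iff)

lemma subst_single: "subst h v (Poly_Mapping.single m c) = h c * (\<Prod>i\<in>UNIV. v i ^ Poly_Mapping.lookup m i)"
  by (simp add: subst_superset[of "{m}"])

lemma subst_0 [simp]: "subst h v 0 = 0"
  by (simp add: subst_def)

lemma subst_Const [simp]: "subst h v (Const c) = h c"
  by (simp add: Const_def subst_single)

lemma subst_1 [simp]: "subst h v 1 = 1"
  using subst_Const[of 1] by (simp only: Const_1 hom_1)

lemma subst_Var [simp]: "subst h v (Var i) = v i"
proof -
  have "(\<Prod>j\<in>UNIV. v j ^ Poly_Mapping.lookup (Poly_Mapping.single i (1::nat)) j) = (\<Prod>j\<in>UNIV. if i = j then v j else 1)"
    by (rule prod.cong) (auto simp: lookup_single when_def)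
  then show ?thesis by (simp add: Var_def subst_single)
qed

lemma subst_add [simp]: "subst h v (p + q) = subst h v p + subst h v q"
proof -
  let ?S = "Poly_Mapping.keys p \<union> Poly_Mapping.keys q"
  have "Poly_Mapping.keys (p + q) \<subseteq> ?S" by (rule keys_add)
  then show ?thesis
    by (simp add: subst_superset[of ?S] lookup_add hom_add ring_distribs sum.distrib)
qed

lemma subst_mult [simp]: "subst h v (p * q) = subst h v p * subst h v q"
proof (induction p rule: poly_mapping_add_induct)
  case p: (single m a)
  show ?case
    by (induction q rule: poly_mapping_add_induct)
      (simp_all add: mult_single subst_single hom_mult lookup_add power_add prod.distrib ring_distribs mult_ac)
qed (simp_all add: ring_distribs)

lemma subst_power [simp]: "subst h v (p ^ n) = subst h v p ^ n"
  by (induction n) simp_all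

lemma subst_sum [simp]: "subst h v (sum g S) = (\<Sum>x\<in>S. subst h v (g x))"
  by (induction S rule: infinite_finite_induct) simp_all

lemma subst_of_nat [simp]: "subst h v (of_nat n) = of_nat n"
  by (induction n) simp_all

lemma subst_numeral [simp]: "subst h v (numeral n) = numeral n"
  using subst_of_nat[of "numeral n"] by simp

end

end

locale coeff_ring_hom = coeff_hom h for h :: "'a::comm_ring_1 \<Rightarrow> 'b::comm_ring_1"
begin

lemma subst_uminus [simp]: "subst h v (- p) = - subst h v p"
proof -
  have "subst h v (- p) + subst h v p = 0" by (simp flip: subst_add)
  then show ?thesis by (simp add: eq_neg_iff_add_eq_0)
qed

lemma subst_diff [simp]: "subst h v (p - q) = subst h v p - subst h v q"
  using subst_add[of v "p - q" q] by (simp add: algebra_simps del: subst_add)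

end

lemma subst_subst:
  assumes "coeff_hom h"
  shows "subst h v (subst Const w p) = subst h (\<lambda>i. subst h v (w i)) p"
proof -
  interpret coeff_hom h by fact
  interpret C: coeff_hom Const by unfold_locales (simp_all add: Const_add Const_mult)
  show ?thesis by (induction p rule: mvpoly_induct) simp_all
qed

section \<open>Partial derivatives\<close>

lemma lookup_pd:
  "Poly_Mapping.lookup (pd i p) m =
     of_nat (Suc (Poly_Mapping.lookup m i)) * Poly_Mapping.lookup p (m + Poly_Mapping.single i 1)"
proof -
  let ?e = "Poly_Mapping.single i (1::nat)"
  have eq: "k - ?e = m \<longleftrightarrow> k = m + ?e" if "Poly_Mapping.lookup k i > 0" for k
  proof -
    have "k = (k - ?e) + ?e"
      using that by (intro poly_mapping_eqI) (auto simp: lookup_add lookup_minus lookup_single when_def)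
    then show ?thesis by (metis add_diff_cancel_right')
  qed
  have "Poly_Mapping.lookup (pd i p) m = (\<Sum>k\<in>Poly_Mapping.keys p.
      if k = m + ?e then of_nat (Poly_Mapping.lookup k i) * Poly_Mapping.lookup p k else 0)"
    unfolding pd_def lookup_sum
  proof (rule sum.cong[OF refl])
    fix k
    show "Poly_Mapping.lookup (Poly_Mapping.single (k - ?e) (of_nat (Poly_Mapping.lookup k i) * Poly_Mapping.lookup p k)) m =
      (if k = m + ?e then of_nat (Poly_Mapping.lookup k i) * Poly_Mapping.lookup p k else 0)"
      using eq[of k] by (cases "Poly_Mapping.lookup k i = 0") (auto simp: lookup_single when_def lookup_add)
  qed
  also have "\<dots> = of_nat (Suc (Poly_Mapping.lookup m i)) * Poly_Mapping.lookup p (m + ?e)"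
    by (auto simp: lookup_add in_keys_iff)
  finally show ?thesis .
qed

lemma pd_add [simp]: "pd i (p + q) = pd i p + pd i q"
  by (rule poly_mapping_eqI) (simp add: lookup_pd lookup_add ring_distribs)

lemma pd_0 [simp]: "pd i 0 = 0"
  by (simp add: pd_def)

lemma pd_single:
  "pd i (Poly_Mapping.single m c) =
     Poly_Mapping.single (m - Poly_Mapping.single i 1) (of_nat (Poly_Mapping.lookup m i) * c)"
  by (cases "c = 0") (simp_all add: pd_def)

lemma pd_Const [simp]: "pd i (Const c) = 0"
  by (simp add: Const_def pd_single)

lemma pd_Var [simp]: "pd i (Var j) = (if i = j then 1 else 0)"
  by (auto simp: Var_def pd_single lookup_single when_def)

lemma pd_mult [simp]:
  fixes p q :: "('a::comm_semiring_1, 'n) mvpoly"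
  shows "pd i (p * q) = pd i p * q + p * pd i q"
proof (induction p rule: poly_mapping_add_induct)
  case p: (single m a)
  show ?case
  proof (induction q rule: poly_mapping_add_induct)
    case (single n b)
    let ?e = "Poly_Mapping.single i (1::nat)"
    have 1: "Poly_Mapping.single (m - ?e + n) (of_nat (Poly_Mapping.lookup m i) * (a * b)) =
      Poly_Mapping.single (m + n - ?e) (of_nat (Poly_Mapping.lookup m i) * (a * b))" for m n :: "'n \<Rightarrow>\<^sub>0 nat" and a b :: 'a
    proof (cases "Poly_Mapping.lookup m i = 0")
      case False
      then have "m - ?e + n = m + n - ?e"
        by (intro poly_mapping_eqI) (auto simp: lookup_add lookup_minus lookup_single when_def)
      then show ?thesis by simp
    qed simp
    show ?case
      using 1[of m n a b] 1[of n m a b]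
      by (simp add: mult_single pd_single lookup_add ring_distribs single_add ac_simps)
  qed (simp_all add: ring_distribs ac_simps)
qed (simp_all add: ring_distribs ac_simps)

lemma pd_commute: "pd i (pd j p) = pd j (pd i p)"
  by (rule poly_mapping_eqI) (auto simp: lookup_pd lookup_add lookup_single when_def ac_simps)

lemma pd_uminus [simp]: "pd i (- p) = - pd i (p :: ('a::comm_ring_1, 'n) mvpoly)"
  by (rule poly_mapping_eqI) (simp add: lookup_pd)

lemma pd_diff [simp]: "pd i (p - q) = pd i p - pd i (q :: ('a::comm_ring_1, 'n) mvpoly)"
  by (rule poly_mapping_eqI) (simp add: lookup_pd lookup_minus ring_distribs)

text \<open>Both sides are derivations along \<open>subst h v\<close> that kill constants, so they
  agree once they agree on variables. Taking for E a partial derivative, \<open>pderiv\<close> or an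
  abstract derivation after substitution gives all chain rules needed below.\<close>

lemma derivation_chain_rule:
  fixes E :: "('a::comm_semiring_1, 'n::finite) mvpoly \<Rightarrow> 'b::comm_semiring_1"
  assumes "coeff_hom h" and add: "\<And>p q. E (p + q) = E p + E q"
    and mult: "\<And>p q. E (p * q) = E p * subst h v q + subst h v p * E q"
    and Const: "\<And>c. E (Const c) = 0"
  shows "E p = (\<Sum>i\<in>UNIV. subst h v (pd i p) * E (Var i))"
proof -
  interpret coeff_hom h by fact
  show ?thesis
  proof (induction p rule: mvpoly_induct)
    case (Var j)
    have "(\<Sum>i\<in>UNIV. subst h v (pd i (Var j)) * E (Var i)) = (\<Sum>i\<in>UNIV. if i = j then E (Var i) else 0)"
      by (rule sum.cong) auto
    then show ?case by simp
  next
    case (mult p q)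
    then show ?case
      by (simp add: assms sum.distrib sum_distrib_left sum_distrib_right ring_distribs mult_ac)
  qed (simp_all add: assms sum.distrib ring_distribs)
qed

lemma pd_subst:
  fixes w :: "'n::finite \<Rightarrow> ('a::comm_semiring_1, 'm) mvpoly"
  shows "pd j (subst Const w p) = (\<Sum>i\<in>UNIV. subst Const w (pd i p) * pd j (w i))"
proof -
  interpret coeff_hom "Const :: 'a \<Rightarrow> ('a, 'm) mvpoly"
    by unfold_locales (simp_all add: Const_add Const_mult)
  show ?thesis
    using derivation_chain_rule[of Const "\<lambda>p. pd j (subst Const w p)" w p]
    by (simp add: coeff_hom_axioms)
qed

section \<open>Homogeneous polynomials and Euler's formula\<close>

lemma homogeneous_add: "homogeneous e p \<Longrightarrow> homogeneous e q \<Longrightarrow> homogeneous e (p + q)"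
  using keys_add[of p q] unfolding homogeneous_def by blast

lemma homogeneous_uminus [simp]: "homogeneous e (- p) \<longleftrightarrow> homogeneous e (p :: ('a::ab_group_add, 'n::finite) mvpoly)"
  by (simp add: homogeneous_def in_keys_iff)

lemma homogeneous_diff: "homogeneous e p \<Longrightarrow> homogeneous e q \<Longrightarrow> homogeneous e (p - q)"
  for p q :: "('a::ab_group_add, 'n::finite) mvpoly"
  using homogeneous_add[of e p "- q"] by simp

lemma homogeneous_mult:
  "homogeneous d p \<Longrightarrow> homogeneous e q \<Longrightarrow> homogeneous (d + e) (p * q)"
  for p q :: "('a::comm_semiring_1, 'n::finite) mvpoly"
  using keys_mult[of p q] unfolding homogeneous_def
  by (force simp: lookup_add sum.distrib)

lemma homogeneous_single: "homogeneous (\<Sum>i\<in>UNIV. Poly_Mapping.lookup m i) (Poly_Mapping.single m c)"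
  by (simp add: homogeneous_def)

lemma homogeneous_sum: "(\<And>x. x \<in> S \<Longrightarrow> homogeneous e (g x)) \<Longrightarrow> homogeneous e (sum g S)"
  by (induction S rule: infinite_finite_induct) (auto intro: homogeneous_add simp: homogeneous_def[of _ 0])

lemma homogeneous_Const: "homogeneous 0 (Const c)"
  by (simp add: homogeneous_def Const_def)

lemma homogeneous_power: "homogeneous d p \<Longrightarrow> homogeneous (n * d) (p ^ n)"
  for p :: "('a::comm_semiring_1, 'n::finite) mvpoly"
  by (induction n) (auto intro: homogeneous_mult simp: homogeneous_def[of _ 1])

lemma sum_lookup_plus_single:
  "(\<Sum>j\<in>UNIV. Poly_Mapping.lookup (m + Poly_Mapping.single i k) j) = (\<Sum>j\<in>UNIV. Poly_Mapping.lookup m j) + k"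
  for m :: "'n::finite \<Rightarrow>\<^sub>0 nat"
proof -
  have "(\<Sum>j\<in>UNIV. Poly_Mapping.lookup (Poly_Mapping.single i k) j) = (\<Sum>j\<in>UNIV. if i = j then k else 0)"
    by (rule sum.cong) (auto simp: lookup_single when_def)
  then show ?thesis by (simp add: lookup_add sum.distrib)
qed

lemma homogeneous_pd: "homogeneous e p \<Longrightarrow> homogeneous (e - 1) (pd i p)"
  unfolding homogeneous_def
proof
  fix m assume hom: "\<forall>m\<in>Poly_Mapping.keys p. (\<Sum>i\<in>UNIV. Poly_Mapping.lookup m i) = e"
    and m: "m \<in> Poly_Mapping.keys (pd i p)"
  then have "m + Poly_Mapping.single i 1 \<in> Poly_Mapping.keys p"
    by (auto simp: in_keys_iff lookup_pd)
  with hom show "(\<Sum>i\<in>UNIV. Poly_Mapping.lookup m i) = e - 1"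
    using sum_lookup_plus_single[of m i 1] by fastforce
qed

lemma euler_identity:
  fixes p :: "('a::comm_semiring_1, 'n::finite) mvpoly"
  assumes "homogeneous e p"
  shows "(\<Sum>i\<in>UNIV. Var i * pd i p) = of_nat e * p"
proof -
  have s: "Var i * pd i (Poly_Mapping.single m c) = of_nat (Poly_Mapping.lookup m i) * Poly_Mapping.single m c" for i :: 'n and m and c :: 'a
  proof (cases "Poly_Mapping.lookup m i = 0")
    case False
    then have "Poly_Mapping.single i 1 + (m - Poly_Mapping.single i 1) = m"
      by (intro poly_mapping_eqI) (auto simp: lookup_add lookup_minus lookup_single when_def)
    then show ?thesis by (simp add: Var_def pd_single mult_single del: single_of_nat flip: single_of_nat)
  qed (simp add: pd_single)
  have "(\<Sum>i\<in>UNIV. Var i * pd i (Poly_Mapping.single m c)) = of_nat e * Poly_Mapping.single m c"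
    if "(\<Sum>i\<in>UNIV. Poly_Mapping.lookup m i) = e" for m :: "'n \<Rightarrow>\<^sub>0 nat" and c :: 'a
    using that by (simp add: s flip: sum_distrib_right of_nat_sum)
  then have *: "(\<Sum>i\<in>UNIV. Var i * pd i (Poly_Mapping.single m c)) = of_nat e * Poly_Mapping.single m c"
    if "m \<in> Poly_Mapping.keys p" for m and c :: 'a
    using that assms by (simp add: homogeneous_def)
  have pds: "pd i (sum g S) = (\<Sum>x\<in>S. pd i (g x))" for i :: 'n and g :: "_ \<Rightarrow> ('a, 'n) mvpoly" and S :: "('n \<Rightarrow>\<^sub>0 nat) set"
    by (induction S rule: infinite_finite_induct) simp_all
  let ?s = "\<lambda>m. Poly_Mapping.single m (Poly_Mapping.lookup p m)"
  have "(\<Sum>i\<in>UNIV. Var i * pd i (\<Sum>m\<in>Poly_Mapping.keys p. ?s m)) = (\<Sum>m\<in>Poly_Mapping.keys p. \<Sum>i\<in>UNIV. Var i * pd i (?s m))"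
    by (subst sum.swap) (simp add: pds sum_distrib_left)
  also have "\<dots> = of_nat e * (\<Sum>m\<in>Poly_Mapping.keys p. ?s m)"
    by (simp add: * sum_distrib_left)
  finally show ?thesis unfolding poly_mapping_conv_sum_single[symmetric] .
qed

section \<open>Ultrapowers and derivations\<close>

definition free_ultrafilter :: "nat set set \<Rightarrow> bool" where
  "free_ultrafilter U \<longleftrightarrow> (\<forall>A\<in>U. infinite A) \<and> (\<forall>A\<in>U. \<forall>B\<in>U. A \<inter> B \<in> U) \<and>
     (\<forall>A\<in>U. \<forall>B. A \<subseteq> B \<longrightarrow> B \<in> U) \<and> (\<forall>A. A \<in> U \<or> - A \<in> U)"

text \<open>Zorn's lemma is applied to families all of whose finite intersections are infinite.
  Asking for infinite instead of nonempty intersections makes a maximal family free. If neither A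
  nor its complement could be added, two finite subfamilies would together have a finite
  intersection.\<close>

lemma free_ultrafilter_exists: "\<exists>U. free_ultrafilter U"
proof -
  define FIP where "FIP = {F. \<forall>S\<subseteq>F. finite S \<longrightarrow> infinite (\<Inter>S :: nat set)}"
  have "\<exists>M\<in>FIP. \<forall>X\<in>FIP. M \<subseteq> X \<longrightarrow> X = M"
  proof (rule subset_Zorn')
    fix C assume C: "subset.chain FIP C"
    show "\<Union>C \<in> FIP"
      unfolding FIP_def
    proof safe
      fix S :: "nat set set" assume S: "S \<subseteq> \<Union>C" "finite S" "finite (\<Inter>S)"
      show False
      proof (cases "S = {}")
        case False
        with S have "C \<noteq> {}" by auto
        with S C obtain c where "c \<in> C" "S \<subseteq> c"
          using finite_subset_Union_chain[of S C FIP] by auto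
        with C S show False by (auto simp: subset.chain_def FIP_def)
      qed (use S in auto)
    qed
  qed
  then obtain M where "M \<in> FIP" and max: "\<And>X. X \<in> FIP \<Longrightarrow> M \<subseteq> X \<Longrightarrow> X = M"
    by blast
  then have M: "infinite (\<Inter>S)" if "S \<subseteq> M" "finite S" for S
    using that by (simp add: FIP_def)
  have ext: "\<exists>S. S \<subseteq> M \<and> finite S \<and> finite (\<Inter>S \<inter> A)" if "A \<notin> M" for A
  proof -
    have "insert A M \<notin> FIP" using max[of "insert A M"] that by auto
    then obtain S where S: "S \<subseteq> insert A M" "finite S" "finite (\<Inter>S)" unfolding FIP_def by blast
    have "\<Inter>(S - {A}) \<inter> A \<subseteq> \<Inter>S" by auto
    then have "finite (\<Inter>(S - {A}) \<inter> A)" using S(3) finite_subset by blast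
    with S show ?thesis by (intro exI[of _ "S - {A}"]) auto
  qed
  have ultra: "A \<in> M \<or> - A \<in> M" for A
  proof (rule ccontr)
    assume "\<not> ?thesis"
    then obtain S T where ST: "S \<subseteq> M" "finite S" "finite (\<Inter>S \<inter> A)" "T \<subseteq> M" "finite T" "finite (\<Inter>T \<inter> - A)"
      using ext[of A] ext[of "- A"] by metis
    have "\<Inter>(S \<union> T) \<subseteq> (\<Inter>S \<inter> A) \<union> (\<Inter>T \<inter> - A)" by blast
    then have "finite (\<Inter>(S \<union> T))" using ST(3,6) finite_subset by blast
    with M[of "S \<union> T"] ST show False by auto
  qed
  have inf: "infinite A" if "A \<in> M" for A
    using M[of "{A}"] that by simp
  have int: "A \<inter> B \<in> M" if "A \<in> M" "B \<in> M" for A B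
  proof (rule ccontr)
    assume "A \<inter> B \<notin> M"
    with ultra[of "A \<inter> B"] that have "infinite (\<Inter>{A, B, - (A \<inter> B)})" by (intro M) auto
    moreover have "\<Inter>{A, B, - (A \<inter> B)} = {}" by blast
    ultimately show False by simp
  qed
  have up: "B \<in> M" if "A \<in> M" "A \<subseteq> B" for A B
  proof (rule ccontr)
    assume "B \<notin> M"
    with ultra[of B] have "- B \<in> M" by blast
    with int[OF that(1)] have "A \<inter> - B \<in> M" by blast
    moreover have "A \<inter> - B = {}" using that by blast
    ultimately show False using inf[of "{}"] by simp
  qed
  show ?thesis
    unfolding free_ultrafilter_def
  proof (intro exI[of _ M] conjI ballI allI impI)
    show "A \<in> M \<or> - A \<in> M" for A by (rule ultra)
  qed (fact inf int up)+
qed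

definition the_ultrafilter :: "nat set set" where
  "the_ultrafilter = (SOME U. free_ultrafilter U)"

lemma free_ultrafilter_the_ultrafilter: "free_ultrafilter the_ultrafilter"
  unfolding the_ultrafilter_def using free_ultrafilter_exists by (rule someI_ex)

lemma the_ultrafilter_infinite: "A \<in> the_ultrafilter \<Longrightarrow> infinite A"
  and the_ultrafilter_Int: "A \<in> the_ultrafilter \<Longrightarrow> B \<in> the_ultrafilter \<Longrightarrow> A \<inter> B \<in> the_ultrafilter"
  and the_ultrafilter_mono: "A \<in> the_ultrafilter \<Longrightarrow> A \<subseteq> B \<Longrightarrow> B \<in> the_ultrafilter"
  and the_ultrafilter_Compl: "A \<notin> the_ultrafilter \<Longrightarrow> - A \<in> the_ultrafilter"
  using free_ultrafilter_the_ultrafilter unfolding free_ultrafilter_def by (metis (no_types))+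

lemma UNIV_in_the_ultrafilter [simp]: "UNIV \<in> the_ultrafilter"
  using the_ultrafilter_Compl[of UNIV] the_ultrafilter_mono[of "{}" UNIV] by auto

lemma the_ultrafilter_mono2:
  "A \<in> the_ultrafilter \<Longrightarrow> B \<in> the_ultrafilter \<Longrightarrow> A \<inter> B \<subseteq> C \<Longrightarrow> C \<in> the_ultrafilter"
  using the_ultrafilter_Int the_ultrafilter_mono by blast

\<comment> \<open>Equality means agreement on a set of the ultrafilter, so equations transfer index
  by index. A sequence of distinct parameters becomes a single element that is transcendental over
  the constants.\<close>
quotient_type 'a ultrapower = "nat \<Rightarrow> 'a" / "\<lambda>x y. {n. x n = y n} \<in> the_ultrafilter"
proof (rule equivpI)
  show "transp (\<lambda>x y :: nat \<Rightarrow> 'a. {n. x n = y n} \<in> the_ultrafilter)"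
    by (rule transpI, erule (1) the_ultrafilter_mono2) auto
qed (auto intro!: reflpI sympI elim: the_ultrafilter_mono)

lift_definition ultra :: "(nat \<Rightarrow> 'a) \<Rightarrow> 'a ultrapower" is "\<lambda>x. x" .

lemma ultra_eq_iff: "ultra x = ultra y \<longleftrightarrow> {n. x n = y n} \<in> the_ultrafilter"
  by transfer simp

instantiation ultrapower :: (field) field
begin

lift_definition zero_ultrapower :: "'a ultrapower" is "\<lambda>_. 0" .
lift_definition one_ultrapower :: "'a ultrapower" is "\<lambda>_. 1" .
lift_definition plus_ultrapower :: "'a ultrapower \<Rightarrow> 'a ultrapower \<Rightarrow> 'a ultrapower" is "\<lambda>x y n. x n + y n"
  by (erule (1) the_ultrafilter_mono2) auto
lift_definition minus_ultrapower :: "'a ultrapower \<Rightarrow> 'a ultrapower \<Rightarrow> 'a ultrapower" is "\<lambda>x y n. x n - y n"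
  by (erule (1) the_ultrafilter_mono2) auto
lift_definition times_ultrapower :: "'a ultrapower \<Rightarrow> 'a ultrapower \<Rightarrow> 'a ultrapower" is "\<lambda>x y n. x n * y n"
  by (erule (1) the_ultrafilter_mono2) auto
lift_definition divide_ultrapower :: "'a ultrapower \<Rightarrow> 'a ultrapower \<Rightarrow> 'a ultrapower" is "\<lambda>x y n. x n / y n"
  by (erule (1) the_ultrafilter_mono2) auto
lift_definition uminus_ultrapower :: "'a ultrapower \<Rightarrow> 'a ultrapower" is "\<lambda>x n. - x n"
  by (erule the_ultrafilter_mono) auto
lift_definition inverse_ultrapower :: "'a ultrapower \<Rightarrow> 'a ultrapower" is "\<lambda>x n. inverse (x n)"
  by (erule the_ultrafilter_mono) auto

instance
proof
  fix a b c :: "'a ultrapower"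
  \<comment> \<open>If the zero indices of a do not form a set of the ultrafilter, their complement
    does; the default \<open>inverse 0 = 0\<close> is taken only outside that complement.\<close>
  show "a \<noteq> 0 \<Longrightarrow> inverse a * a = 1"
    by transfer (auto dest!: the_ultrafilter_Compl elim: the_ultrafilter_mono)
  show "(0::'a ultrapower) \<noteq> 1"
    by transfer (auto dest: the_ultrafilter_infinite)
qed (transfer, simp add: algebra_simps divide_inverse)+

end

lemma ultra_0: "ultra (\<lambda>_. 0) = 0"
  and ultra_1: "ultra (\<lambda>_. 1) = 1"
  and ultra_add: "ultra (\<lambda>n. x n + y n) = ultra x + ultra y"
  and ultra_mult: "ultra (\<lambda>n. x n * y n) = ultra x * ultra y"
  by (transfer, simp)+

lemma of_nat_ultrapower: "of_nat k = ultra (\<lambda>_. of_nat k)"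
  by (induction k) (simp_all add: ultra_0 ultra_1 ultra_add)

instance ultrapower :: (field_char_0) field_char_0
proof
  show "inj (of_nat :: nat \<Rightarrow> 'a ultrapower)"
    by (rule injI) (auto simp: of_nat_ultrapower ultra_eq_iff dest: the_ultrafilter_infinite split: if_splits)
qed

text \<open>A derivation of the subring A with values in the ambient field; D is a total function,
  but only its values on A are constrained. Subrings suffice, because adjoining y then only requires
  the values of polynomials at y.\<close>

definition derivation_on :: "'a::field_char_0 set \<Rightarrow> ('a \<Rightarrow> 'a) \<Rightarrow> bool" where
  "derivation_on A D \<longleftrightarrow> 1 \<in> A \<and> (\<forall>a\<in>A. - a \<in> A) \<and> (\<forall>a\<in>A. \<forall>b\<in>A. a + b \<in> A \<and> a * b \<in> A \<and>
     D (a + b) = D a + D b \<and> D (a * b) = D a * b + a * D b)"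

abbreviation poly_over :: "'a::zero set \<Rightarrow> 'a poly \<Rightarrow> bool" where
  "poly_over A p \<equiv> (\<forall>i. coeff p i \<in> A)"

context
  fixes A :: "'a::field_char_0 set" and D :: "'a \<Rightarrow> 'a"
  assumes der: "derivation_on A D"
begin

lemma derivation_on_closed:
  "1 \<in> A" "0 \<in> A" "a \<in> A \<Longrightarrow> - a \<in> A" "a \<in> A \<Longrightarrow> b \<in> A \<Longrightarrow> a + b \<in> A" "a \<in> A \<Longrightarrow> b \<in> A \<Longrightarrow> a - b \<in> A"
  "a \<in> A \<Longrightarrow> b \<in> A \<Longrightarrow> a * b \<in> A" "(\<And>x. x \<in> S \<Longrightarrow> g x \<in> A) \<Longrightarrow> sum g S \<in> A"
proof -
  show 1: "1 \<in> A" and m: "a \<in> A \<Longrightarrow> - a \<in> A" and a: "a \<in> A \<Longrightarrow> b \<in> A \<Longrightarrow> a + b \<in> A"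
    and "a \<in> A \<Longrightarrow> b \<in> A \<Longrightarrow> a * b \<in> A" for a b
    using der by (auto simp: derivation_on_def)
  show 0: "0 \<in> A" using a[OF 1 m[OF 1]] by simp
  show "a \<in> A \<Longrightarrow> b \<in> A \<Longrightarrow> a - b \<in> A" using a[of a "- b"] m[of b] by simp
  show "(\<And>x. x \<in> S \<Longrightarrow> g x \<in> A) \<Longrightarrow> sum g S \<in> A" for S and g :: "'b \<Rightarrow> 'a"
    by (induction S rule: infinite_finite_induct) (auto intro: 0 a)
qed

lemma derivation_on_add: "a \<in> A \<Longrightarrow> b \<in> A \<Longrightarrow> D (a + b) = D a + D b"
  and derivation_on_mult: "a \<in> A \<Longrightarrow> b \<in> A \<Longrightarrow> D (a * b) = D a * b + a * D b"
  using der by (auto simp: derivation_on_def)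

lemma derivation_on_0: "D 0 = 0"
  using derivation_on_add[of 0 0] derivation_on_closed(2) by simp

lemma poly_over_closed:
  "poly_over A p \<Longrightarrow> poly_over A q \<Longrightarrow> poly_over A (p + q)"
  "poly_over A p \<Longrightarrow> poly_over A q \<Longrightarrow> poly_over A (p - q)"
  "poly_over A p \<Longrightarrow> poly_over A q \<Longrightarrow> poly_over A (p * q)"
  "poly_over A p \<Longrightarrow> a \<in> A \<Longrightarrow> poly_over A (smult a p)"
  "a \<in> A \<Longrightarrow> poly_over A (monom a n)"
  by (auto simp: coeff_mult intro: derivation_on_closed)

lemma poly_over_pCons: "poly_over A (pCons a p) \<longleftrightarrow> a \<in> A \<and> poly_over A p"
  by (auto simp: coeff_pCons split: nat.splits)

text \<open>\<open>poly_derivation y e p\<close> is the value at \<open>p y\<close> of the extension of \<open>D\<close> that maps \<open>y\<close> to \<open>e\<close>.\<close>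

definition poly_derivation :: "'a \<Rightarrow> 'a \<Rightarrow> 'a poly \<Rightarrow> 'a" where
  "poly_derivation y e p = poly (map_poly D p) y + poly (pderiv p) y * e"

lemma poly_derivation_pCons:
  "poly_derivation y e (pCons a p) = D a + y * poly_derivation y e p + poly p y * e"
  by (simp add: poly_derivation_def derivation_on_0 map_poly_pCons pderiv_pCons algebra_simps)

lemma poly_derivation_0 [simp]: "poly_derivation y e 0 = 0"
  by (simp add: poly_derivation_def)

lemma poly_derivation_add:
  assumes "poly_over A p" "poly_over A q"
  shows "poly_derivation y e (p + q) = poly_derivation y e p + poly_derivation y e q"
proof -
  have "map_poly D (p + q) = map_poly D p + map_poly D q"
    using assms by (intro poly_eqI) (simp add: coeff_map_poly derivation_on_0 derivation_on_add)
  then show ?thesis by (simp add: poly_derivation_def pderiv_add algebra_simps)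
qed

lemma poly_derivation_smult:
  assumes "a \<in> A" "poly_over A p"
  shows "poly_derivation y e (smult a p) = D a * poly p y + a * poly_derivation y e p"
  using assms(2)
proof (induction p)
  case (pCons b p)
  then show ?case
    using assms(1) by (simp add: poly_over_pCons poly_derivation_pCons derivation_on_mult algebra_simps)
qed simp

lemma poly_derivation_mult:
  assumes "poly_over A p" "poly_over A q"
  shows "poly_derivation y e (p * q) = poly_derivation y e p * poly q y + poly p y * poly_derivation y e q"
  using assms(1)
proof (induction p)
  case (pCons b p)
  have p: "b \<in> A" "poly_over A p" using pCons.prems by (simp_all add: poly_over_pCons)
  have "poly_over A (smult b q)" "poly_over A (pCons 0 (p * q))"
    using poly_over_closed(4)[OF assms(2) p(1)] poly_over_closed(3)[OF p(2) assms(2)] derivation_on_closed(2)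
    by (simp_all add: poly_over_pCons)
  then show ?case
    using pCons.IH[OF p(2)] p assms(2)
    by (simp add: poly_derivation_add poly_derivation_smult poly_derivation_pCons derivation_on_0 algebra_simps)
qed simp

text \<open>The Leibniz rule forces the value of the extension at p(y). The hypothesis says that
  relations of y have derivative 0, which is exactly what makes this value independent of p.\<close>

lemma derivation_on_extend_by:
  assumes ker: "\<And>p. poly_over A p \<Longrightarrow> poly p y = 0 \<Longrightarrow> poly_derivation y e p = 0"
  shows "\<exists>A' D'. derivation_on A' D' \<and> A \<subseteq> A' \<and> (\<forall>a\<in>A. D' a = D a) \<and> y \<in> A' \<and> D' y = e"
proof (intro exI conjI)
  define A' where "A' = {poly p y | p. poly_over A p}"
  define D' where "D' z = poly_derivation y e (SOME p. poly_over A p \<and> poly p y = z)" for z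
  have D': "D' (poly p y) = poly_derivation y e p" if p: "poly_over A p" for p
  proof -
    define q where "q = (SOME q. poly_over A q \<and> poly q y = poly p y)"
    have q: "poly_over A q" "poly q y = poly p y"
      using someI[of "\<lambda>q. poly_over A q \<and> poly q y = poly p y" p] p by (auto simp: q_def)
    have pq: "poly_over A (p - q)" using p q by (intro poly_over_closed) auto
    have "poly_derivation y e (p - q) = 0"
      using ker[OF pq] q(2) by simp
    then show ?thesis
      using poly_derivation_add[OF pq q(1), of y e] by (simp add: D'_def q_def)
  qed
  show "derivation_on A' D'"
    unfolding derivation_on_def
  proof (intro conjI ballI)
    show "1 \<in> A'" unfolding A'_def
      by (rule CollectI, rule exI[of _ 1]) (use derivation_on_closed in auto)
  next
    fix a assume "a \<in> A'"
    then obtain p where "poly_over A p" "a = poly p y" by (auto simp: A'_def)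
    then show "- a \<in> A'" unfolding A'_def
      by (intro CollectI exI[of _ "- p"]) (auto intro: derivation_on_closed)
  next
    fix a b assume "a \<in> A'" "b \<in> A'"
    then obtain p q where p: "poly_over A p" "a = poly p y" and q: "poly_over A q" "b = poly q y"
      by (auto simp: A'_def)
    have s: "poly_over A (p + q)" and m: "poly_over A (p * q)"
      using poly_over_closed(1,3)[OF p(1) q(1)] by blast+
    show "a + b \<in> A'" unfolding A'_def using s p q by (intro CollectI exI[of _ "p + q"]) auto
    show "a * b \<in> A'" unfolding A'_def using m p q by (intro CollectI exI[of _ "p * q"]) auto
    show "D' (a + b) = D' a + D' b"
      using D'[OF s] D'[OF p(1)] D'[OF q(1)] poly_derivation_add[OF p(1) q(1), of y e] p q by simp
    show "D' (a * b) = D' a * b + a * D' b"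
      using D'[OF m] D'[OF p(1)] D'[OF q(1)] poly_derivation_mult[OF p(1) q(1), of y e] p q by simp
  qed
  have c: "poly_over A [:a:]" if "a \<in> A" for a
    using that derivation_on_closed(2) by (auto simp: coeff_pCons split: nat.splits)
  show "A \<subseteq> A'"
  proof
    fix a assume "a \<in> A"
    then show "a \<in> A'" unfolding A'_def using c by (intro CollectI exI[of _ "[:a:]"]) auto
  qed
  show "\<forall>a\<in>A. D' a = D a"
    using D'[OF c] by (auto simp: poly_derivation_pCons)
  have Y: "poly_over A [:0, 1:]"
    using derivation_on_closed by (auto simp: coeff_pCons split: nat.splits)
  then show "y \<in> A'" unfolding A'_def by (intro CollectI exI[of _ "[:0, 1:]"]) auto
  have "D 1 = 0" using derivation_on_mult[of 1 1] derivation_on_closed(1) by simp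
  then show "D' y = e" using D'[OF Y] by (simp add: poly_derivation_pCons derivation_on_0)
qed

text \<open>If y satisfies no relation over A, every value e is admissible. Otherwise a nonzero
  relation m of least degree determines e: by minimality and characteristic zero, m' does not vanish
  at y. All other relations are reduced to smaller degree modulo m.\<close>

lemma derivation_on_extend:
  "\<exists>A' D'. derivation_on A' D' \<and> A \<subseteq> A' \<and> (\<forall>a\<in>A. D' a = D a) \<and> y \<in> A'"
proof -
  have "\<exists>e. \<forall>p. poly_over A p \<longrightarrow> poly p y = 0 \<longrightarrow> poly_derivation y e p = 0"
  proof (cases "\<exists>p. poly_over A p \<and> poly p y = 0 \<and> p \<noteq> 0")
    case False
    then show ?thesis by (intro exI[of _ 0]) (metis poly_derivation_0)
  next
    case True
    define n where "n = (LEAST n. \<exists>p. poly_over A p \<and> poly p y = 0 \<and> p \<noteq> 0 \<and> degree p = n)"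
    from True have "\<exists>n. \<exists>p. poly_over A p \<and> poly p y = 0 \<and> p \<noteq> 0 \<and> degree p = n" by blast
    from LeastI_ex[OF this] obtain m where m: "poly_over A m" "poly m y = 0" "m \<noteq> 0" "degree m = n"
      unfolding n_def by blast
    have min: "p = 0" if "poly_over A p" "poly p y = 0" "degree p < n" for p
      using not_less_Least[of "degree p" "\<lambda>n. \<exists>p. poly_over A p \<and> poly p y = 0 \<and> p \<noteq> 0 \<and> degree p = n"] that
      unfolding n_def by blast
    have "n \<noteq> 0"
    proof
      assume "n = 0"
      then obtain c where "m = [:c:]" using m(4) degree_eq_zeroE by blast
      with m(2,3) show False by simp
    qed
    have over_pderiv: "poly_over A (pderiv m)"
    proof
      fix i
      have "of_nat k * a \<in> A" if "a \<in> A" for k a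
        using that by (induction k) (auto simp: ring_distribs intro: derivation_on_closed)
      then show "coeff (pderiv m) i \<in> A" using m(1) unfolding coeff_pderiv by blast
    qed
    have "poly (pderiv m) y \<noteq> 0"
    proof
      assume "poly (pderiv m) y = 0"
      with over_pderiv have "pderiv m = 0"
        using min m(4) \<open>n \<noteq> 0\<close> by (metis degree_pderiv diff_less zero_less_one not_gr_zero)
      with m(4) \<open>n \<noteq> 0\<close> show False by (simp add: pderiv_eq_0_iff)
    qed
    \<comment> \<open>The solution of (D m)(y) + m'(y) e = 0.\<close>
    define e where "e = - poly (map_poly D m) y / poly (pderiv m) y"
    have Em: "poly_derivation y e m = 0"
      using \<open>poly (pderiv m) y \<noteq> 0\<close> by (simp add: poly_derivation_def e_def)
    have "poly_derivation y e p = 0" if "poly_over A p" "poly p y = 0" for p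
      using that
    proof (induction "degree p" arbitrary: p rule: less_induct)
      case less
      show ?case
      proof (cases "degree p < n")
        case True
        then have "p = 0" using min less.prems by blast
        then show ?thesis by simp
      next
        case False
        \<comment> \<open>Pseudo-division: A is only a ring, so p is multiplied by the leading
          coefficient of m before its leading term is cancelled.\<close>
        define r where "r = monom (lead_coeff p) (degree p - n) * m"
        define q where "q = smult (lead_coeff m) p - r"
        have over_mon: "poly_over A (monom (lead_coeff p) (degree p - n))"
          by (rule poly_over_closed(5)) (use less.prems in blast)
        then have over_r: "poly_over A r"
          unfolding r_def using m(1) by (intro poly_over_closed(3))
        then have over_q: "poly_over A q"
          unfolding q_def using less.prems(1) m(1) by (intro poly_over_closed(2,4)) simp_all
        have "p \<noteq> 0" using False \<open>n \<noteq> 0\<close> by auto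
        then have deg: "degree r = degree p"
          using False m by (simp add: r_def degree_mult_eq degree_monom_eq monom_eq_0_iff)
        have "lead_coeff r = lead_coeff p * lead_coeff m"
          unfolding r_def using \<open>p \<noteq> 0\<close> by (simp add: lead_coeff_mult degree_monom_eq)
        then have "coeff q (degree p) = 0" by (simp add: q_def deg[symmetric])
        moreover have "degree q \<le> degree p"
          unfolding q_def using deg by (intro degree_diff_le) (auto intro: order.trans[OF degree_smult_le])
        ultimately have "degree q < degree p"
          using False \<open>n \<noteq> 0\<close>
          by (metis degree_0 le_neq_implies_less leading_coeff_0_iff not_gr_zero)
        moreover have "poly q y = 0" by (simp add: q_def r_def less.prems m(2))
        ultimately have "poly_derivation y e q = 0" using less.hyps over_q by blast
        moreover have "poly_derivation y e r = 0"
          using poly_derivation_mult[OF over_mon m(1), of y e] by (simp add: r_def Em m(2))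
        moreover have "smult (lead_coeff m) p = q + r" by (simp add: q_def)
        \<comment> \<open>The Leibniz rule also produces \<open>D (lead_coeff m) * poly p y\<close>,
          which vanishes because y is a root of p.\<close>
        ultimately have "lead_coeff m * poly_derivation y e p = 0"
          using poly_derivation_smult[of "lead_coeff m" p y e] poly_derivation_add[OF over_q over_r, of y e]
            less.prems m(1) by simp
        then show ?thesis using m(3) by simp
      qed
    qed
    then show ?thesis by blast
  qed
  then show ?thesis using derivation_on_extend_by by metis
qed

end

lemma derivation_on_extend_finite:
  assumes "derivation_on A D" "finite S"
  shows "\<exists>A' D'. derivation_on A' D' \<and> A \<subseteq> A' \<and> (\<forall>a\<in>A. D' a = D a) \<and> S \<subseteq> A'"
  using assms(2)
proof (induction S rule: finite_induct)
  case (insert y S)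
  then obtain A' D' where 1: "derivation_on A' D'" "A \<subseteq> A'" "\<forall>a\<in>A. D' a = D a" "S \<subseteq> A'" by blast
  from derivation_on_extend[OF 1(1), of y] obtain A'' D'' where
    "derivation_on A'' D''" "A' \<subseteq> A''" "\<forall>a\<in>A'. D'' a = D' a" "y \<in> A''" by blast
  with 1 show ?case by (intro exI[of _ A''] exI[of _ D'']) auto
qed (use assms in blast)

text \<open>Start with the zero derivation on the constants. As t satisfies no nontrivial relation
  over them, it may be given the derivative 1; the elements of S are then adjoined one at a
  time.\<close>

lemma derivation_along_transcendental:
  fixes k :: "'a::field_char_0 \<Rightarrow> 'b::field_char_0"
  assumes "coeff_ring_hom k" and tr: "\<And>p. p \<noteq> 0 \<Longrightarrow> poly (map_poly k p) t \<noteq> 0" and "finite S"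
  shows "\<exists>A D. derivation_on A D \<and> range k \<subseteq> A \<and> t \<in> A \<and> S \<subseteq> A \<and> (\<forall>c. D (k c) = 0) \<and> D t = 1"
proof -
  interpret coeff_ring_hom k by fact
  have neg: "- k a = k (- a)" for a
    using hom_add[of a "- a"] by (simp add: eq_neg_iff_add_eq_0[symmetric])
  have D: "derivation_on (range k) (\<lambda>_. 0)"
    unfolding derivation_on_def by (auto simp: neg simp flip: hom_add hom_mult hom_1)
  have "poly_derivation (\<lambda>_. 0) t 1 p = 0" if over: "poly_over (range k) p" and 0: "poly p t = 0" for p
  proof -
    have "\<exists>q. p = map_poly k q" using over
    proof (induction p)
      case 0
      then show ?case by (intro exI[of _ 0]) simp
    next
      case (pCons a p)
      have "a \<in> range k" "poly_over (range k) p"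
        using pCons.prems by (simp_all add: poly_over_pCons[OF D])
      with pCons.IH obtain q b where "p = map_poly k q" "a = k b" by blast
      then show ?case by (intro exI[of _ "pCons b q"]) (simp add: map_poly_pCons)
    qed
    with 0 tr have "p = 0" by (metis map_poly_0)
    then show ?thesis by (simp add: poly_derivation_0[OF D])
  qed
  from derivation_on_extend_by[OF D this] obtain A D where 1: "derivation_on A D" "range k \<subseteq> A"
    "\<forall>a\<in>range k. D a = 0" "t \<in> A" "D t = 1" by blast
  then have "D (k c) = 0" "k c \<in> A" for c by auto
  from derivation_on_extend_finite[OF 1(1) assms(3)] obtain A' D' where
    "derivation_on A' D'" "A \<subseteq> A'" "\<forall>a\<in>A. D' a = D a" "S \<subseteq> A'" by blast
  with 1 \<open>\<And>c. D (k c) = 0\<close> \<open>\<And>c. k c \<in> A\<close> show ?thesis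
    by (intro exI[of _ A'] exI[of _ D']) auto
qed

section \<open>Restriction to the line\<close>

lemma vector_4 [simp]:
  fixes w x y z :: "'a::zero"
  shows
  "(vector [w, x, y, z] :: 'a ^ 4) $ 1 = w"
  "(vector [w, x, y, z] :: 'a ^ 4) $ 2 = x"
  "(vector [w, x, y, z] :: 'a ^ 4) $ 3 = y"
  "(vector [w, x, y, z] :: 'a ^ 4) $ 4 = z"
  by (simp_all add: vector_def)

lemma prod_4: "prod g (UNIV :: 4 set) = g 1 * g 2 * g 3 * g 4"
  unfolding UNIV_4 by (simp add: ac_simps)

interpretation Const: coeff_ring_hom "Const :: 'a::comm_ring_1 \<Rightarrow> ('a, 'n::finite) mvpoly"
  by unfold_locales (simp_all add: Const_add Const_mult)

interpretation const_poly: coeff_ring_hom "\<lambda>c :: 'a::comm_ring_1. [:c:]"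
  by unfold_locales (simp_all add: pCons_one)

interpretation coeff_id: coeff_ring_hom "\<lambda>c :: 'a::comm_ring_1. c"
  by unfold_locales simp_all

declare coeff_id.hom_0 [simp del] coeff_id.hom_1 [simp del]

lemma eval_simps [simp]:
  fixes x :: "'a::comm_ring_1 ^ 'n::finite"
  shows "eval x 0 = 0" "eval x 1 = 1" "eval x (Const c) = c" "eval x (Var i) = x $ i"
    "eval x (p + q) = eval x p + eval x q" "eval x (p * q) = eval x p * eval x q"
    "eval x (p - q) = eval x p - eval x q" "eval x (- p) = - eval x p" "eval x (numeral k) = numeral k"
    "eval x (p ^ n) = eval x p ^ n" "eval x (of_nat n) = of_nat n" "eval x (sum g S) = (\<Sum>y\<in>S. eval x (g y))"
  by (simp_all add: eval_def)

section \<open>Taylor coefficients along a parametrized line\<close>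

context coeff_ring_hom
begin

lemma coeff_ring_hom_const_poly: "coeff_ring_hom (\<lambda>c. [:h c:])"
  by unfold_locales (simp_all add: pCons_one hom_add hom_mult)

end

lemma subst_line:
  fixes h :: "'a::comm_ring_1 \<Rightarrow> 'b::idom" and x q :: "'n::finite \<Rightarrow> 'b"
  assumes "coeff_ring_hom h"
  defines "T \<equiv> subst (\<lambda>c. [:h c:]) (\<lambda>i. [:x i, q i:])"
  shows coeff_subst_line_0: "coeff (T p) 0 = subst h x p"
    and coeff_subst_line_1: "coeff (T p) 1 = (\<Sum>i\<in>UNIV. q i * subst h x (pd i p))"
    and coeff_subst_line_2:
      "2 * coeff (T p) 2 = (\<Sum>i\<in>UNIV. \<Sum>j\<in>UNIV. q i * q j * subst h x (pd j (pd i p)))"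
proof -
  interpret coeff_ring_hom h by fact
  interpret T: coeff_ring_hom "\<lambda>c. [:h c:]" by (rule coeff_ring_hom_const_poly)
  show 0: "coeff (T p) 0 = subst h x p" for p
    unfolding T_def by (induction p rule: mvpoly_induct) (simp_all add: coeff_mult)
  have D: "pderiv (T p) = (\<Sum>i\<in>UNIV. T (pd i p) * [:q i:])" for p
    unfolding T_def
    by (subst derivation_chain_rule[where h = "\<lambda>c. [:h c:]" and E = "\<lambda>p. pderiv (subst (\<lambda>c. [:h c:]) (\<lambda>i. [:x i, q i:]) p)"])
      (simp_all add: T.coeff_hom_axioms pderiv_add pderiv_mult pderiv_pCons algebra_simps)
  \<comment> \<open>Comparing coefficients in the chain rule gives a recursion: each Taylor
    coefficient comes from the preceding one of the partial derivatives.\<close>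
  have S: "of_nat (Suc n) * coeff (T p) (Suc n) = (\<Sum>i\<in>UNIV. q i * coeff (T (pd i p)) n)" for n p
    using arg_cong[OF D, of "\<lambda>r. coeff r n" p] by (simp add: coeff_pderiv coeff_sum mult.commute)
  show 1: "coeff (T p) 1 = (\<Sum>i\<in>UNIV. q i * subst h x (pd i p))" for p
    using S[of 0 p] by (simp add: 0)
  show "2 * coeff (T p) 2 = (\<Sum>i\<in>UNIV. \<Sum>j\<in>UNIV. q i * q j * subst h x (pd j (pd i p)))"
    using S[of 1 p] 1 by (simp add: sum_distrib_left mult.assoc numeral_2_eq_2)
qed

section \<open>Forms on the line in the affine coordinate x_2 / x_1\<close>

definition line_poly :: "('a::comm_ring_1, 4) mvpoly \<Rightarrow> 'a poly" where
  "line_poly = subst (\<lambda>c. [:c:]) (\<lambda>i. (vector [1, [:0, 1:], 0, 0] :: 'a poly ^ 4) $ i)"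

lemma line_poly_simps [simp]:
  "line_poly (p + q) = line_poly p + line_poly q" "line_poly (p - q) = line_poly p - line_poly q"
  "line_poly (p * q) = line_poly p * line_poly q" "line_poly (- p) = - line_poly p"
  "line_poly (Var 1) = 1" "line_poly (Var 2) = [:0, 1:]" "line_poly (Var 3) = 0" "line_poly (Var 4) = 0"
  "line_poly (Const c) = [:c:]"
  by (simp_all add: line_poly_def)

lemma poly_line_poly: "poly (line_poly p) y = eval (vector [1, y, 0, 0]) p"
proof (induction p rule: mvpoly_induct)
  case (Var i)
  have "\<forall>i. poly (line_poly (Var i)) y = eval (vector [1, y, 0, 0]) (Var i)"
    by (simp add: forall_4)
  then show ?case by blast
qed simp_all

lemma pderiv_line_poly: "pderiv (line_poly p) = line_poly (pd 2 p)"
  for p :: "('a::idom, 4) mvpoly"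
  unfolding line_poly_def
  by (subst derivation_chain_rule[where h = "\<lambda>c. [:c:]" and E = "\<lambda>p. pderiv (line_poly p)"
        and v = "\<lambda>i. (vector [1, [:0, 1:], 0, 0] :: 'a poly ^ 4) $ i", unfolded line_poly_def])
    (simp_all add: const_poly.coeff_hom_axioms pderiv_add pderiv_mult pderiv_pCons sum_4 algebra_simps)

text \<open>The degree fixes the exponent of x_1, so setting x_1 = 1 loses no coefficient of the
  restricted form.\<close>

lemma coeff_line_poly:
  assumes "homogeneous e p" "l \<le> e"
  shows "coeff (line_poly p) l = Poly_Mapping.lookup p (Poly_Mapping.single 1 (e - l) + Poly_Mapping.single 2 l)"
    (is "_ = Poly_Mapping.lookup p ?m")
proof -
  have "coeff (line_poly p) l = (\<Sum>m\<in>Poly_Mapping.keys p. if m = ?m then Poly_Mapping.lookup p m else 0)"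
    unfolding line_poly_def subst_def coeff_sum
  proof (rule sum.cong[OF refl])
    fix m assume "m \<in> Poly_Mapping.keys p"
    then have e: "Poly_Mapping.lookup m 1 + Poly_Mapping.lookup m 2 + Poly_Mapping.lookup m 3 + Poly_Mapping.lookup m 4 = e"
      using assms(1) by (simp add: homogeneous_def sum_4)
    have "m = ?m \<longleftrightarrow> Poly_Mapping.lookup m 2 = l \<and> Poly_Mapping.lookup m 3 = 0 \<and> Poly_Mapping.lookup m 4 = 0"
      using e assms(2) by (auto simp: poly_mapping_eq_iff fun_eq_iff forall_4 lookup_add lookup_single)
    moreover have "[:0, 1:] ^ k = monom (1::'a) k" for k
      by (simp add: monom_altdef)
    ultimately show "coeff ([:Poly_Mapping.lookup p m:] * (\<Prod>i\<in>UNIV. (vector [1, [:0, 1:], 0, 0] :: 'a poly ^ 4) $ i ^ Poly_Mapping.lookup m i)) l =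
      (if m = ?m then Poly_Mapping.lookup p m else 0)"
      by (auto simp: prod_4 power_0_left)
  qed
  also have "\<dots> = Poly_Mapping.lookup p ?m"
    by (simp add: in_keys_iff)
  finally show ?thesis .
qed

lemma lookup_eq_0_if_line_poly_eq_0:
  assumes "homogeneous e p" "line_poly p = 0" "Poly_Mapping.lookup m 3 = 0" "Poly_Mapping.lookup m 4 = 0"
  shows "Poly_Mapping.lookup p m = 0"
proof (rule ccontr)
  assume "Poly_Mapping.lookup p m \<noteq> 0"
  then have "m \<in> Poly_Mapping.keys p" by (simp add: in_keys_iff)
  with assms have e: "Poly_Mapping.lookup m 1 + Poly_Mapping.lookup m 2 = e"
    by (force simp: homogeneous_def sum_4)
  then have "m = Poly_Mapping.single 1 (e - Poly_Mapping.lookup m 2) + Poly_Mapping.single 2 (Poly_Mapping.lookup m 2)"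
    using assms by (auto simp: poly_mapping_eq_iff fun_eq_iff forall_4 lookup_add lookup_single)
  with coeff_line_poly[OF assms(1), of "Poly_Mapping.lookup m 2"] e assms(2) \<open>Poly_Mapping.lookup p m \<noteq> 0\<close>
  show False by simp
qed

lemma line_poly_eq_0_iff:
  fixes p :: "('a::field_char_0, 4) mvpoly"
  shows "line_poly p = 0 \<longleftrightarrow> (\<forall>y. eval (vector [1, y, 0, 0]) p = 0)"
  by (simp add: poly_all_0_iff_0 flip: poly_line_poly)

lemma restrict_l_simps [simp]:
  fixes p q :: "('a::idom, 4) mvpoly"
  shows
  "restrict_l (p + q) = restrict_l p + restrict_l q" "restrict_l (p - q) = restrict_l p - restrict_l q"
  "restrict_l (p * q) = restrict_l p * restrict_l q" "restrict_l (- p) = - restrict_l p"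
  "restrict_l (p ^ n) = restrict_l p ^ n"
  "restrict_l (Var 3 :: ('a, 4) mvpoly) = 0" "restrict_l (Var 4 :: ('a, 4) mvpoly) = 0"
  "restrict_l (0 :: ('a, 4) mvpoly) = 0" "restrict_l (1 :: ('a, 4) mvpoly) = 1"
  "restrict_l (of_nat n :: ('a, 4) mvpoly) = of_nat n" "restrict_l (numeral k :: ('a, 4) mvpoly) = numeral k"
proof -
  have n: "to_fract (of_nat n) = (of_nat n :: ('a, 2) mvpoly fract)" for n by (induction n) simp_all
  have p: "to_fract (x ^ n) = to_fract x ^ n" for x :: "('a, 2) mvpoly" and n by (induction n) simp_all
  show "restrict_l (p ^ n) = restrict_l p ^ n" by (simp add: restrict_l_def p)
  show "restrict_l (of_nat n :: ('a, 4) mvpoly) = of_nat n" by (simp add: restrict_l_def n)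
  show "restrict_l (numeral k :: ('a, 4) mvpoly) = numeral k" using n[of "numeral k"] by (simp add: restrict_l_def)
qed (simp_all add: restrict_l_def)

lemma line_poly_conv_restriction:
  "line_poly p = subst (\<lambda>c. [:c:]) (\<lambda>i. (vector [1, [:0, 1:]] :: 'a poly ^ 2) $ i)
     (subst Const (\<lambda>i. (vector [Var 1, Var 2, 0, 0] :: ('a::comm_ring_1, 2) mvpoly ^ 4) $ i) p)"
proof -
  have "\<forall>i. (vector [1, [:0, 1:], 0, 0] :: 'a poly ^ 4) $ i =
     subst (\<lambda>c. [:c:]) (\<lambda>i. (vector [1, [:0, 1:]] :: 'a poly ^ 2) $ i) ((vector [Var 1, Var 2, 0, 0] :: ('a, 2) mvpoly ^ 4) $ i)"
    by (simp add: forall_4)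
  then show ?thesis
    by (subst subst_subst) (simp_all add: const_poly.coeff_hom_axioms line_poly_def)
qed

lemma line_poly_eq_0_if_restrict_l_eq_0: "restrict_l p = 0 \<Longrightarrow> line_poly p = 0"
  by (simp add: restrict_l_def line_poly_conv_restriction)

lemma restrict_l_eq_0_iff_line_poly:
  assumes "homogeneous e p"
  shows "restrict_l p = 0 \<longleftrightarrow> line_poly p = 0"
proof
  assume 0: "line_poly p = 0"
  have "Const (Poly_Mapping.lookup p m) *
      (\<Prod>i\<in>UNIV. (vector [Var 1, Var 2, 0, 0] :: ('a, 2) mvpoly ^ 4) $ i ^ Poly_Mapping.lookup m i) = 0" for m
    using lookup_eq_0_if_line_poly_eq_0[OF assms 0, of m] by (auto simp: prod_4 power_0_left simp del: mult_eq_0_iff prod_zero_iff)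
  then have "subst Const (\<lambda>i. (vector [Var 1, Var 2, 0, 0] :: ('a, 2) mvpoly ^ 4) $ i) p = 0"
    unfolding subst_def by (intro sum.neutral) blast
  then show "restrict_l p = 0" by (simp add: restrict_l_def)
qed (rule line_poly_eq_0_if_restrict_l_eq_0)

text \<open>Monomials containing x_4 go to q. The others must contain x_3, since the coefficients of
  monomials in x_1 and x_2 alone vanish with f on the line.\<close>

lemma decompose_along_line:
  assumes hom: "homogeneous d f" and 0: "line_poly f = 0"
  obtains p q where "f = Var 3 * p + Var 4 * q" "homogeneous (d - 1) p" "homogeneous (d - 1) q"
proof -
  define part where "part i S = (\<Sum>m\<in>S. Poly_Mapping.single (m - Poly_Mapping.single i 1) (Poly_Mapping.lookup f m))"
    for i :: 4 and S
  define S3 where "S3 = {m\<in>Poly_Mapping.keys f. Poly_Mapping.lookup m 4 = 0}"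
  define S4 where "S4 = {m\<in>Poly_Mapping.keys f. Poly_Mapping.lookup m 4 > 0}"
  have restore: "m - Poly_Mapping.single i 1 + Poly_Mapping.single i 1 = m"
    if "Poly_Mapping.lookup m i > 0" for m :: "4 \<Rightarrow>\<^sub>0 nat" and i
    using that by (intro poly_mapping_eqI) (auto simp: lookup_add lookup_minus lookup_single when_def)
  have p: "Var i * part i S = (\<Sum>m\<in>S. Poly_Mapping.single m (Poly_Mapping.lookup f m))"
    if "\<And>m. m \<in> S \<Longrightarrow> Poly_Mapping.lookup m i > 0" for i S
    unfolding part_def sum_distrib_left
    by (intro sum.cong refl) (simp add: Var_def mult_single add.commute[of "Poly_Mapping.single i 1"] restore that del: One_nat_def)
  have h: "homogeneous (d - 1) (part i S)"
    if "\<And>m. m \<in> S \<Longrightarrow> Poly_Mapping.lookup m i > 0" "S \<subseteq> Poly_Mapping.keys f" for i S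
    unfolding part_def
  proof (rule homogeneous_sum)
    fix m assume m: "m \<in> S"
    have "(\<Sum>j\<in>UNIV. Poly_Mapping.lookup m j) = d"
      using m that(2) hom by (auto simp: homogeneous_def)
    then have "(\<Sum>j\<in>UNIV. Poly_Mapping.lookup (m - Poly_Mapping.single i 1) j) = d - 1"
      using sum_lookup_plus_single[of "m - Poly_Mapping.single i 1" i 1] restore[of m i] that(1)[OF m] by simp
    then show "homogeneous (d - 1) (Poly_Mapping.single (m - Poly_Mapping.single i 1) (Poly_Mapping.lookup f m))"
      using homogeneous_single by metis
  qed
  have 3: "Poly_Mapping.lookup m 3 > 0" if "m \<in> S3" for m
    using that lookup_eq_0_if_line_poly_eq_0[OF hom 0, of m] by (auto simp: S3_def in_keys_iff)
  have 4: "Poly_Mapping.lookup m 4 > 0" if "m \<in> S4" for m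
    using that by (simp add: S4_def)
  have p3: "Var 3 * part 3 S3 = (\<Sum>m\<in>S3. Poly_Mapping.single m (Poly_Mapping.lookup f m))"
    by (rule p) (rule 3)
  have p4: "Var 4 * part 4 S4 = (\<Sum>m\<in>S4. Poly_Mapping.single m (Poly_Mapping.lookup f m))"
    by (rule p) (rule 4)
  show thesis
  proof (rule that)
    have "f = (\<Sum>m\<in>S3 \<union> S4. Poly_Mapping.single m (Poly_Mapping.lookup f m))"
      by (subst poly_mapping_conv_sum_single) (intro sum.cong, auto simp: S3_def S4_def)
    also have "\<dots> = Var 3 * part 3 S3 + Var 4 * part 4 S4"
      unfolding p3 p4 by (rule sum.union_disjoint) (auto simp: S3_def S4_def)
    finally show "f = Var 3 * part 3 S3 + Var 4 * part 4 S4" .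
    show "homogeneous (d - 1) (part 3 S3)" using 3 by (intro h) (auto simp: S3_def)
    show "homogeneous (d - 1) (part 4 S4)" using 4 by (intro h) (auto simp: S4_def)
  qed
qed

section \<open>The flex form and the function \<open>b\<^sub>0\<close>\<close>

text \<open>
  The first and second derivatives of the fibre over \<open>(s : t)\<close> with respect to \<open>y\<^sub>2\<close> and \<open>y\<^sub>3\<close>.  The
  evaluation map \<open>e\<close> of the derivatives of \<open>p\<close> and \<open>q\<close> will be the identity, evaluation at a point, or
  restriction to the line.
\<close>

definition fib_2 ::
    "(('a::comm_ring_1, 4) mvpoly \<Rightarrow> 'b::comm_ring_1) \<Rightarrow> ('a, 4) mvpoly \<Rightarrow> ('a, 4) mvpoly \<Rightarrow>
     'b \<Rightarrow> 'b \<Rightarrow> 'b" where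
  "fib_2 e p q s t = s * e (pd 2 p) + t * e (pd 2 q)"

definition fib_3 ::
    "(('a::comm_ring_1, 4) mvpoly \<Rightarrow> 'b::comm_ring_1) \<Rightarrow> ('a, 4) mvpoly \<Rightarrow> ('a, 4) mvpoly \<Rightarrow>
     'b \<Rightarrow> 'b \<Rightarrow> 'b" where
  "fib_3 e p q s t = s * (s * e (pd 3 p) + t * e (pd 4 p)) + t * (s * e (pd 3 q) + t * e (pd 4 q))"

definition fib_22 ::
    "(('a::comm_ring_1, 4) mvpoly \<Rightarrow> 'b::comm_ring_1) \<Rightarrow> ('a, 4) mvpoly \<Rightarrow> ('a, 4) mvpoly \<Rightarrow>
     'b \<Rightarrow> 'b \<Rightarrow> 'b" where
  "fib_22 e p q s t = s * e (pd 2 (pd 2 p)) + t * e (pd 2 (pd 2 q))"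

definition fib_23 ::
    "(('a::comm_ring_1, 4) mvpoly \<Rightarrow> 'b::comm_ring_1) \<Rightarrow> ('a, 4) mvpoly \<Rightarrow> ('a, 4) mvpoly \<Rightarrow>
     'b \<Rightarrow> 'b \<Rightarrow> 'b" where
  "fib_23 e p q s t = s * (s * e (pd 3 (pd 2 p)) + t * e (pd 4 (pd 2 p))) +
     t * (s * e (pd 3 (pd 2 q)) + t * e (pd 4 (pd 2 q)))"

definition fib_33 ::
    "(('a::comm_ring_1, 4) mvpoly \<Rightarrow> 'b::comm_ring_1) \<Rightarrow> ('a, 4) mvpoly \<Rightarrow> ('a, 4) mvpoly \<Rightarrow>
     'b \<Rightarrow> 'b \<Rightarrow> 'b" where
  "fib_33 e p q s t =
     s * (s * s * e (pd 3 (pd 3 p)) + 2 * s * t * e (pd 4 (pd 3 p)) + t * t * e (pd 4 (pd 4 p))) +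
     t * (s * s * e (pd 3 (pd 3 q)) + 2 * s * t * e (pd 4 (pd 3 q)) + t * t * e (pd 4 (pd 4 q)))"

text \<open>
  The second derivative of the fibre in the tangent direction \<open>(0, F\<^sub>3, -F\<^sub>2)\<close>, where \<open>F\<^sub>i\<close> are its
  first derivatives.
\<close>

definition flex_form ::
    "(('a::comm_ring_1, 4) mvpoly \<Rightarrow> 'b::comm_ring_1) \<Rightarrow> ('a, 4) mvpoly \<Rightarrow> ('a, 4) mvpoly \<Rightarrow>
     'b \<Rightarrow> 'b \<Rightarrow> 'b" where
  "flex_form e p q s t = fib_22 e p q s t * (fib_3 e p q s t)\<^sup>2
     - 2 * fib_23 e p q s t * fib_2 e p q s t * fib_3 e p q s t
     + fib_33 e p q s t * (fib_2 e p q s t)\<^sup>2"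

lemmas fib_defs = fib_2_def fib_3_def fib_22_def fib_23_def fib_33_def

section \<open>Degrees of the flex form\<close>

lemma fib_scale:
  "fib_2 e p q (c * s) (c * t) = c * fib_2 e p q s t"
  "fib_3 e p q (c * s) (c * t) = c ^ 2 * fib_3 e p q s t"
  "fib_22 e p q (c * s) (c * t) = c * fib_22 e p q s t"
  "fib_23 e p q (c * s) (c * t) = c ^ 2 * fib_23 e p q s t"
  "fib_33 e p q (c * s) (c * t) = c ^ 3 * fib_33 e p q s t"
  by (simp_all add: fib_defs algebra_simps power2_eq_square power3_eq_cube)

text \<open>A derivative of the fibre has degree 1 in (s, t), plus 1 for each differentiation by
  y_3. The three summands thus have degrees 1 + 4, 2 + 1 + 2 and 3 + 2.\<close>

lemma flex_form_scale: "flex_form e p q (c * s) (c * t) = c ^ 5 * flex_form e p q s t"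
proof -
  have "c ^ 5 = c * c * c * c * c" by (simp add: eval_nat_numeral mult_ac)
  then show ?thesis
    by (simp add: flex_form_def fib_scale algebra_simps power2_eq_square power3_eq_cube)
qed

definition flex_poly :: "('a::comm_ring_1, 4) mvpoly \<Rightarrow> ('a, 4) mvpoly \<Rightarrow> ('a, 4) mvpoly" where
  "flex_poly p q = flex_form (\<lambda>r. r) p q q (- p)"

lemma eval_flex_poly: "eval x (flex_poly p q) = flex_form (eval x) p q (eval x q) (- eval x p)"
  by (simp add: flex_poly_def flex_form_def fib_defs)

lemma restrict_l_flex_poly:
  fixes p q :: "('a::idom, 4) mvpoly"
  shows "restrict_l (flex_poly p q) = flex_form restrict_l p q (restrict_l q) (- restrict_l p)"
  by (simp add: flex_poly_def flex_form_def fib_defs)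

text \<open>Homogeneity admits the flex form as a test form for the projective closure and makes its
  restriction detectable by \<open>line_poly\<close>. Writing the degree as
  \<open>Suc (Suc e)\<close> avoids truncated subtraction in the second derivatives.\<close>

lemma homogeneous_flex_poly:
  assumes p: "homogeneous (Suc (Suc e)) p" and q: "homogeneous (Suc (Suc e)) q"
  shows "\<exists>k. homogeneous k (flex_poly p q)"
proof -
  let ?n = "Suc (Suc e)"
  have n: "homogeneous ?n (- p)" using p by simp
  have 1: "homogeneous (Suc e) (pd i p)" "homogeneous (Suc e) (pd i q)" for i
    using homogeneous_pd[OF p, of i] homogeneous_pd[OF q, of i] by simp_all
  have 2: "homogeneous e (pd i (pd j p))" "homogeneous e (pd i (pd j q))" for i j
    using homogeneous_pd[OF 1(1), of i j] homogeneous_pd[OF 1(2), of i j] by simp_all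
  have two: "homogeneous 0 (2 :: ('a, 4) mvpoly)"
    using homogeneous_Const[of "2 :: 'a"] by (metis Const_add Const_1 one_add_one)
  note H = homogeneous_mult homogeneous_add p q n 1 2 two
  have h2: "homogeneous (?n + Suc e) (fib_2 (\<lambda>r. r) p q q (- p))"
    unfolding fib_defs by (intro H)
  have h3: "homogeneous (?n + (?n + Suc e)) (fib_3 (\<lambda>r. r) p q q (- p))"
    unfolding fib_defs by (intro H)
  have h22: "homogeneous (?n + e) (fib_22 (\<lambda>r. r) p q q (- p))"
    unfolding fib_defs by (intro H)
  have h23: "homogeneous (?n + (?n + e)) (fib_23 (\<lambda>r. r) p q q (- p))"
    unfolding fib_defs by (intro H)
  have two': "homogeneous (?n + ?n + e) (2 * a * b * c)"
    if "homogeneous ?n a" "homogeneous ?n b" "homogeneous e c" for a b c :: "('a, 4) mvpoly"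
    using homogeneous_mult[OF homogeneous_mult[OF homogeneous_mult[OF two that(1)] that(2)] that(3)] by simp
  have h33: "homogeneous (?n + (?n + ?n + e)) (fib_33 (\<lambda>r. r) p q q (- p))"
    unfolding fib_defs by (intro H two')
  have A: "homogeneous (?n + e + 2 * (?n + (?n + Suc e))) (fib_22 (\<lambda>r. r) p q q (- p) * (fib_3 (\<lambda>r. r) p q q (- p))\<^sup>2)"
    by (intro homogeneous_mult homogeneous_power h22 h3)
  have B: "homogeneous (0 + (?n + (?n + e)) + (?n + Suc e) + (?n + (?n + Suc e)))
      (2 * fib_23 (\<lambda>r. r) p q q (- p) * fib_2 (\<lambda>r. r) p q q (- p) * fib_3 (\<lambda>r. r) p q q (- p))"
    by (intro homogeneous_mult two h23 h2 h3)
  have C: "homogeneous (?n + (?n + ?n + e) + 2 * (?n + Suc e)) (fib_33 (\<lambda>r. r) p q q (- p) * (fib_2 (\<lambda>r. r) p q q (- p))\<^sup>2)"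
    by (intro homogeneous_mult homogeneous_power h33 h2)
  have eq: "0 + (?n + (?n + e)) + (?n + Suc e) + (?n + (?n + Suc e)) = ?n + e + 2 * (?n + (?n + Suc e))"
    "?n + (?n + ?n + e) + 2 * (?n + Suc e) = ?n + e + 2 * (?n + (?n + Suc e))" by simp_all
  show ?thesis
    unfolding flex_poly_def flex_form_def
    using A B C unfolding eq by (blast intro: homogeneous_add homogeneous_diff)
qed

text \<open>The polynomial variable plays the role of v: this is the contribution of x_2^l x_3^i
  x_4^j to the coefficient of v^3 at x_2 = u + B v, x_3 = v, x_4 = C v. For l < 3 - (i + j) both
  sides are 0, since the binomial coefficient vanishes.\<close>

lemma coeff_linear_power_mult_monom:
  fixes u B C :: "'a::comm_ring_1"
  shows "coeff ([:u, B:] ^ l * [:0, 1:] ^ i * [:0, C:] ^ j) 3 =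
    (if i + j \<le> 3 then of_nat (l choose (3 - (i + j))) * B ^ (3 - (i + j)) * u ^ (l - (3 - (i + j))) * C ^ j else 0)"
proof -
  have "[:0, C:] = monom C 1" by (simp add: monom_altdef)
  then have "[:0, C:] ^ j = monom (C ^ j) j" by (simp add: monom_power)
  moreover have "[:0, 1:] ^ i = monom (1::'a) i" by (simp add: monom_altdef)
  ultimately have "[:u, B:] ^ l * [:0, 1:] ^ i * [:0, C:] ^ j = monom (C ^ j) (i + j) * [:u, B:] ^ l"
    by (simp add: mult_monom mult.assoc)
  moreover have "coeff ([:u, B:] ^ l) k = of_nat (l choose k) * B ^ k * u ^ (l - k)" for k
  proof (cases "k \<le> l")
    case True
    then show ?thesis by (rule coeff_linear_poly_power)
  next
    case False
    have "degree ([:u, B:] ^ l) \<le> l" 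
      by (rule order.trans[OF degree_power_le]) simp
    then have "coeff ([:u, B:] ^ l) k = 0" using False by (intro coeff_eq_0) simp
    then show ?thesis using False by (simp add: binomial_eq_0)
  qed
  ultimately show ?thesis by (simp add: coeff_monom_mult)
qed

text \<open>
  In the paper's notation, \<open>b\<^sub>0\<close> is the coefficient of \<open>u\<^bsup>d-3\<^esup> v\<^sup>3\<close> in \<open>f (u, A u + B v, v, C v)\<close>.
\<close>

lemma b0_eq_coeff:
  fixes f :: "('a::field_char_0, 4) mvpoly" and X1 X2 :: "('a, 2) mvpoly fract"
  assumes "homogeneous d f" "d \<ge> 4" and X2: "X2 = fA f * X1"
  shows "X1 ^ (d - 3) * b0 d f =
    coeff (subst (\<lambda>c. [:to_fract (Const c):]) (\<lambda>i. [:(vector [X1, X2, 0, 0] :: _ ^ 4) $ i, (vector [0, fB f, 1, fC f] :: _ ^ 4) $ i:]) f) 3"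
proof -
  let ?A = "fA f" and ?B = "fB f" and ?C = "fC f"
  define J where "J = {(j1 :: nat, j2, j3). j1 + j2 \<le> 3 \<and> j3 \<le> d - 3}"
  define mon where "mon = (\<lambda>(j1, j2, j3). Poly_Mapping.single (3::4) j1 + Poly_Mapping.single 4 j2 +
      Poly_Mapping.single 1 j3 + Poly_Mapping.single 2 (d - (j1 + j2 + j3)))"
  define h where "h c = to_fract (Const c :: ('a, 2) mvpoly)" for c
  define trm where "trm m = h (Poly_Mapping.lookup f m) * (X1 ^ Poly_Mapping.lookup m 1 *
     (let k = Poly_Mapping.lookup m 3 + Poly_Mapping.lookup m 4; l = Poly_Mapping.lookup m 2 in
      if k \<le> 3 then of_nat (l choose (3 - k)) * ?B ^ (3 - k) * X2 ^ (l - (3 - k)) * ?C ^ Poly_Mapping.lookup m 4 else 0))" for m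
  have lookups: "Poly_Mapping.lookup (mon (j1, j2, j3)) 1 = j3" "Poly_Mapping.lookup (mon (j1, j2, j3)) 2 = d - (j1 + j2 + j3)"
     "Poly_Mapping.lookup (mon (j1, j2, j3)) 3 = j1" "Poly_Mapping.lookup (mon (j1, j2, j3)) 4 = j2" for j1 j2 j3
    by (simp_all add: mon_def lookup_add lookup_single)
  have fin: "finite J"
    by (rule finite_subset[of _ "{..3} \<times> {..3} \<times> {..d}"]) (auto simp: J_def)
  have inj: "inj_on mon J"
  proof (rule inj_onI)
    fix x y assume eq: "mon x = mon y"
    obtain a b c a' b' c' where xy: "x = (a, b, c)" "y = (a', b', c')" by (cases x, cases y)
    show "x = y"
      using lookups(1,3,4)[of a b c] lookups(1,3,4)[of a' b' c'] eq unfolding xy by simp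
  qed
  \<comment> \<open>With i + j > 3 the power of v is too large. If i + j is at most 3 and the
    exponent of x_1 exceeds d - 3, then l < 3 - (i + j) and the binomial coefficient is 0.\<close>
  have outside: "trm m = 0" if m: "m \<in> Poly_Mapping.keys f" "m \<notin> mon ` J" for m
  proof (rule ccontr)
    assume nz: "trm m \<noteq> 0"
    define i j k l where "i = Poly_Mapping.lookup m 3" and "j = Poly_Mapping.lookup m 4"
      and "k = Poly_Mapping.lookup m 1" and "l = Poly_Mapping.lookup m 2"
    note ijkl = i_def j_def k_def l_def
    have d: "i + j + k + l = d"
      using m(1) assms(1) by (force simp: homogeneous_def sum_4 ijkl)
    have ij: "i + j \<le> 3" using nz by (auto simp: trm_def Let_def ijkl split: if_splits)
    have "l choose (3 - (i + j)) \<noteq> 0"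
    proof
      assume "l choose (3 - (i + j)) = 0"
      then have "trm m = 0" by (simp add: trm_def Let_def binomial_eq_0 flip: ijkl)
      with nz show False by blast
    qed
    then have "k \<le> d - 3" using d ij assms(2) by (auto simp: binomial_eq_0_iff)
    then have "(i, j, k) \<in> J" using ij by (simp add: J_def)
    moreover have "m = mon (i, j, k)"
    proof -
      have "d - (i + j + k) = l" using d by simp
      then show ?thesis
        unfolding poly_mapping_eq_iff fun_eq_iff forall_4 lookups by (simp add: ijkl)
    qed
    ultimately show False using m(2) by blast
  qed
  have eq: "X1 ^ (d - 3) * (of_nat ((d - (j1 + j2 + j3)) choose (3 - (j1 + j2))) *
      to_fract (Const (alpha f j1 j2 j3 (d - (j1 + j2 + j3)))) * ?A ^ (d - 3 - j3) * ?B ^ (3 - (j1 + j2)) * ?C ^ j2) =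
      trm (mon (j1, j2, j3))" if "(j1, j2, j3) \<in> J" for j1 j2 j3
  proof -
    have le: "j1 + j2 \<le> 3" "j3 \<le> d - 3" using that by (simp_all add: J_def)
    have e: "d - (j1 + j2 + j3) - (3 - (j1 + j2)) = d - 3 - j3" using le assms(2) by simp
    \<comment> \<open>The second factor turns the power of A into a power of X2 = A X1; the first is
      the power of x_1 in the monomial.\<close>
    have "X1 ^ (d - 3) = X1 ^ j3 * X1 ^ (d - 3 - j3)"
      unfolding power_add[symmetric] using le assms(2) by simp
    moreover have "alpha f j1 j2 j3 (d - (j1 + j2 + j3)) = Poly_Mapping.lookup f (mon (j1, j2, j3))"
      by (simp add: alpha_def mon_def)
    ultimately show ?thesis
      using le by (simp add: trm_def Let_def lookups e X2 power_mult_distrib h_def mult_ac add.commute[of j3 3])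
  qed
  have "X1 ^ (d - 3) * b0 d f = (\<Sum>x\<in>J. trm (mon x))"
    unfolding b0_def J_def[symmetric] sum_distrib_left
    by (intro sum.cong refl) (use eq in auto)
  also have "\<dots> = (\<Sum>m\<in>mon ` J. trm m)"
    by (simp add: sum.reindex[OF inj])
  also have "\<dots> = (\<Sum>m\<in>mon ` J \<union> Poly_Mapping.keys f. trm m)"
    using fin outside by (intro sum.mono_neutral_left) auto
  also have "\<dots> = (\<Sum>m\<in>Poly_Mapping.keys f. trm m)"
    using fin by (intro sum.mono_neutral_right) (auto simp: trm_def h_def in_keys_iff)
  also have "\<dots> = coeff (subst (\<lambda>c. [:h c:]) (\<lambda>i. [:(vector [X1, X2, 0, 0] :: _ ^ 4) $ i, (vector [0, ?B, 1, ?C] :: _ ^ 4) $ i:]) f) 3"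
    unfolding subst_def coeff_sum
  proof (rule sum.cong[OF refl])
    fix m
    show "trm m = coeff ([:h (Poly_Mapping.lookup f m):] * (\<Prod>i\<in>UNIV.
        [:(vector [X1, X2, 0, 0] :: _ ^ 4) $ i, (vector [0, ?B, 1, ?C] :: _ ^ 4) $ i:] ^ Poly_Mapping.lookup m i)) 3"
      using coeff_linear_power_mult_monom[of X2 ?B "Poly_Mapping.lookup m 2" "Poly_Mapping.lookup m 3" ?C "Poly_Mapping.lookup m 4"]
      by (simp add: prod_4 trm_def Let_def poly_const_pow mult.assoc)
  qed
  finally show ?thesis by (simp add: h_def)
qed

section \<open>Comparison of \<open>b0\<close> with the flex form\<close>

lemma Var_neq_0: "Var i \<noteq> (0 :: ('a::zero_neq_one, 'n) mvpoly)"
proof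
  assume "Var i = (0 :: ('a, 'n) mvpoly)"
  then have "Poly_Mapping.lookup (Var i :: ('a, 'n) mvpoly) (Poly_Mapping.single i 1) = 0" by simp
  then show False by (simp add: Var_def)
qed

interpretation to_fract_Const: coeff_ring_hom "\<lambda>c. to_fract (Const c :: ('a::idom, 2) mvpoly)"
  by unfold_locales (simp_all add: Const_add Const_mult)

lemma restrict_l_conv_subst:
  fixes p :: "('a::idom, 4) mvpoly"
  shows "restrict_l p = subst (\<lambda>c. to_fract (Const c))
    (\<lambda>i. (vector [to_fract (Var 1), to_fract (Var 2), 0, 0] :: ('a, 2) mvpoly fract ^ 4) $ i) p"
proof (induction p rule: mvpoly_induct)
  case (Var i)
  have "\<forall>i. restrict_l (Var i :: ('a, 4) mvpoly) = (vector [to_fract (Var 1), to_fract (Var 2), 0, 0] :: ('a, 2) mvpoly fract ^ 4) $ i"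
    by (simp add: forall_4 restrict_l_def)
  then show ?case by (simp add: to_fract_Const.subst_Var)
qed (simp_all add: restrict_l_def)

text \<open>The hypothesis \<open>W\<close> keeps all denominators nonzero: \<open>dd 2 f\<close>
  restricts to the Wronskian, and q cannot vanish on the line, for then its x_2-derivative and hence
  the Wronskian would vanish too.\<close>

lemma b0_eq_0_iff:
  fixes f p q :: "('a::field_char_0, 4) mvpoly"
  assumes d: "d \<ge> 4" and f: "f = Var 3 * p + Var 4 * q" and hom_f: "homogeneous d f"
    and hom: "homogeneous (d - 1) p" "homogeneous (d - 1) q"
    and W: "line_poly q * line_poly (pd 2 p) \<noteq> line_poly p * line_poly (pd 2 q)"
  shows "b0 d f = 0 \<longleftrightarrow> line_poly (flex_poly p q) = 0"
proof -
  define r :: "('a, 4) mvpoly \<Rightarrow> ('a, 2) mvpoly fract" where "r = restrict_l"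
  define X1 X2 where "X1 = to_fract (Var 1 :: ('a, 2) mvpoly)" and "X2 = to_fract (Var 2 :: ('a, 2) mvpoly)"
  have r_simps: "r (Var 1) = X1" "r (Var 2) = X2"
    by (simp_all add: r_def X1_def X2_def restrict_l_def)
  have X1: "X1 \<noteq> 0" by (simp add: X1_def Var_neq_0)
  define a b where "a = r p" and "b = r q"
  \<comment> \<open>(1:C) = (q:-p) is the parameter of the fibre through the generic point of the
    line.\<close>
  define C where "C = - (a / b)"
  have w2: "b * r (pd 2 p) - a * r (pd 2 q) \<noteq> 0"
  proof
    assume "b * r (pd 2 p) - a * r (pd 2 q) = 0"
    then have "restrict_l (q * pd 2 p - p * pd 2 q) = 0" by (simp add: a_def b_def r_def)
    then have "line_poly (q * pd 2 p - p * pd 2 q) = 0" by (rule line_poly_eq_0_if_restrict_l_eq_0)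
    with W show False by simp
  qed
  have b: "b \<noteq> 0"
  proof
    assume "b = 0"
    then have "line_poly q = 0" unfolding b_def r_def by (rule line_poly_eq_0_if_restrict_l_eq_0)
    with W pderiv_line_poly[of q] show False by simp
  qed
  have bC: "b * C = - a" using b by (simp add: C_def)
  note scale = fib_scale[of r p q b 1 C, unfolded mult_1_right bC]
  have g2: "fib_2 r p q 1 C \<noteq> 0"
  proof
    assume "fib_2 r p q 1 C = 0"
    with scale(1) w2 show False by (simp add: fib_2_def)
  qed
  have two: "(2 :: ('a, 2) mvpoly fract) \<noteq> 0"
  proof -
    have "to_fract (2 :: ('a, 2) mvpoly) \<noteq> 0" by simp
    moreover have "to_fract (2 :: ('a, 2) mvpoly) = 2"
      using to_fract_add[of 1 "1 :: ('a, 2) mvpoly"] by simp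
    ultimately show ?thesis by (simp only: not_False_eq_True)
  qed
  have f3: "r (pd 3 f) = a" and f4: "r (pd 4 f) = b"
    by (simp_all add: f r_def a_def b_def)
  have fC: "fC f = C"
    using f3 f4 by (simp add: fC_def C_def r_def)
  have dd2: "r (dd 2 f) = fib_2 r p q b (- a)"
    by (simp add: dd_def f r_def a_def b_def fib_2_def algebra_simps)
  have dd1: "r (dd 1 f) = b * r (pd 1 p) - a * r (pd 1 q)"
    by (simp add: dd_def f r_def a_def b_def algebra_simps)
  have euler: "X1 * r (pd 1 h) + X2 * r (pd 2 h) = of_nat (d - 1) * r h" if "homogeneous (d - 1) h" for h
    using arg_cong[OF euler_identity[OF that], of r] by (simp add: sum_4 r_def r_simps[unfolded r_def])
  \<comment> \<open>Euler's formula for p and q turns the sum of both sides into (d - 1)(b a - a b)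
    = 0.\<close>
  have "X1 * r (dd 1 f) = - (X2 * r (dd 2 f))"
  proof -
    have "X1 * r (dd 1 f) + X2 * r (dd 2 f) =
        b * (X1 * r (pd 1 p) + X2 * r (pd 2 p)) - a * (X1 * r (pd 1 q) + X2 * r (pd 2 q))"
      by (simp add: dd1 dd2 fib_2_def algebra_simps)
    also have "\<dots> = 0" unfolding euler[OF hom(1)] euler[OF hom(2)] by (simp add: a_def b_def)
    finally show ?thesis by (simp add: eq_neg_iff_add_eq_0)
  qed
  moreover have "r (dd 2 f) \<noteq> 0" using w2 by (simp add: dd2 fib_2_def)
  ultimately have fA: "X2 = fA f * X1"
    by (simp add: fA_def r_def field_simps)
  \<comment> \<open>Chosen so that (0, B, 1) is R divided by -F_2.\<close>
  define B where "B = - fib_3 r p q 1 C / fib_2 r p q 1 C"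
  have fB: "fB f = B"
  proof -
    have "r (pd 3 f * dd 4 f - pd 4 f * dd 3 f) = - 2 * fib_3 r p q b (- a)"
      by (simp add: dd_def f r_def a_def b_def fib_3_def algebra_simps)
    moreover have "r (2 * dd 2 f * pd 4 f) = 2 * fib_2 r p q b (- a) * b"
      using dd2 f4 by (simp add: r_def)
    ultimately show ?thesis
      using b g2 two by (simp add: fB_def B_def r_def[symmetric] scale power2_eq_square field_simps)
  qed
  define T where "T = subst (\<lambda>c. [:to_fract (Const c):]) (\<lambda>i. [:(vector [X1, X2, 0, 0] :: ('a, 2) mvpoly fract ^ 4) $ i,
      (vector [0, B, 1, C] :: ('a, 2) mvpoly fract ^ 4) $ i:])"
  interpret T: coeff_ring_hom "\<lambda>c. [:to_fract (Const c :: ('a, 2) mvpoly):]"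
    by (rule to_fract_Const.coeff_ring_hom_const_poly)
  have c2: "2 * coeff (T h) 2 = (\<Sum>i\<in>UNIV. \<Sum>j\<in>UNIV. (vector [0, B, 1, C] :: ('a, 2) mvpoly fract ^ 4) $ i *
      (vector [0, B, 1, C] :: ('a, 2) mvpoly fract ^ 4) $ j * r (pd j (pd i h)))" for h
    unfolding T_def r_def restrict_l_conv_subst X1_def[symmetric] X2_def[symmetric]
    by (rule coeff_subst_line_2) (rule to_fract_Const.coeff_ring_hom_axioms)
  \<comment> \<open>Since x_3 = v and x_4 = C v, f is v times the equation p + C q of the fibre. The
    coefficient of v^3 in f is therefore the quadratic Taylor coefficient of the fibre.\<close>
  have "T f = [:0, 1:] * T p + [:0, C:] * T q"
    unfolding T_def f by simp
  then have "coeff (T f) 3 = coeff (T p) 2 + C * coeff (T q) 2"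
    by (simp add: numeral_3_eq_3 numeral_2_eq_2)
  then have "2 * coeff (T f) 3 = 2 * coeff (T p) 2 + C * (2 * coeff (T q) 2)"
    by (simp add: algebra_simps)
  also have "\<dots> = fib_22 r p q 1 C * B\<^sup>2 + 2 * fib_23 r p q 1 C * B + fib_33 r p q 1 C"
    unfolding c2 by (simp add: sum_4 fib_defs pd_commute algebra_simps power2_eq_square)
  finally have "2 * (X1 ^ (d - 3) * b0 d f) = fib_22 r p q 1 C * B\<^sup>2 + 2 * fib_23 r p q 1 C * B + fib_33 r p q 1 C"
    using b0_eq_coeff[OF hom_f d fA] unfolding fB fC T_def by simp
  then have "2 * (X1 ^ (d - 3) * b0 d f) * (fib_2 r p q 1 C)\<^sup>2 = flex_form r p q 1 C"
    using g2 by (simp add: B_def flex_form_def field_simps power2_eq_square)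
  moreover have "r (flex_poly p q) = b ^ 5 * flex_form r p q 1 C"
    using flex_form_scale[of r p q b 1 C] bC by (simp add: r_def restrict_l_flex_poly a_def b_def)
  ultimately have "b0 d f = 0 \<longleftrightarrow> restrict_l (flex_poly p q) = 0"
    using b g2 X1 two by (auto simp: r_def)
  moreover obtain k where "homogeneous k (flex_poly p q)"
  proof -
    have "d - 1 = Suc (Suc (d - 3))" using d by simp
    then show ?thesis using homogeneous_flex_poly[of "d - 3" p q] hom that by metis
  qed
  ultimately show ?thesis using restrict_l_eq_0_iff_line_poly by blast
qed

text \<open>
  A vector \<open>n\<close> orthogonal to the independent vectors \<open>P\<close> and \<open>Q\<close> is a multiple of their cross
  product, so \<open>(0, n\<^sub>3, -n\<^sub>2)\<close> is a multiple of \<open>P\<^sub>1 Q - Q\<^sub>1 P\<close>.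
\<close>

lemma orthogonal_to_independent:
  fixes n P Q :: "'a::field ^ 3"
  assumes P: "P \<noteq> 0" and Q: "\<And>c. Q \<noteq> c *s P"
    and nP: "n $ 1 * P $ 1 + n $ 2 * P $ 2 + n $ 3 * P $ 3 = 0"
    and nQ: "n $ 1 * Q $ 1 + n $ 2 * Q $ 2 + n $ 3 * Q $ 3 = 0"
  obtains c where "n $ 3 = c * (P $ 1 * Q $ 2 - Q $ 1 * P $ 2)" "- n $ 2 = c * (P $ 1 * Q $ 3 - Q $ 1 * P $ 3)"
proof -
  define N1 N2 N3 where N: "N1 = P $ 2 * Q $ 3 - P $ 3 * Q $ 2" "N2 = P $ 3 * Q $ 1 - P $ 1 * Q $ 3"
    "N3 = P $ 1 * Q $ 2 - P $ 2 * Q $ 1"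
  have nz: "N1 \<noteq> 0 \<or> N2 \<noteq> 0 \<or> N3 \<noteq> 0"
  proof (rule ccontr)
    assume "\<not> ?thesis"
    then have eq: "P $ 2 * Q $ 3 = P $ 3 * Q $ 2" "P $ 3 * Q $ 1 = P $ 1 * Q $ 3" "P $ 1 * Q $ 2 = P $ 2 * Q $ 1"
      by (simp_all add: N)
    from P obtain k where k: "P $ k \<noteq> 0" by (auto simp: vec_eq_iff)
    have "\<forall>i. Q $ i * P $ k = Q $ k * P $ i"
      using exhaust_3[of k] eq by (auto simp: forall_3 mult.commute)
    then have "Q = (Q $ k / P $ k) *s P"
      using k by (simp add: vec_eq_iff field_simps)
    with Q show False by blast
  qed
  have c: "n $ 2 * N3 = n $ 3 * N2" "n $ 3 * N1 = n $ 1 * N3" "n $ 1 * N2 = n $ 2 * N1"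
    using nP nQ unfolding N by algebra+
  obtain c where "n $ 2 = c * N2" "n $ 3 = c * N3"
  proof -
    consider "N1 \<noteq> 0" | "N2 \<noteq> 0" | "N3 \<noteq> 0" using nz by blast
    then show thesis
    proof cases
      case 1
      show ?thesis by (rule that[of "n $ 1 / N1"]) (use c 1 in \<open>simp_all add: field_simps\<close>)
    next
      case 2
      show ?thesis by (rule that[of "n $ 2 / N2"]) (use c 2 in \<open>simp_all add: field_simps\<close>)
    next
      case 3
      show ?thesis by (rule that[of "n $ 3 / N3"]) (use c 3 in \<open>simp_all add: field_simps\<close>)
    qed
  qed
  then show thesis by (intro that[of c]) (simp_all add: N algebra_simps)
qed

text \<open>
  By Euler's formula the Hessian \<open>H\<close> satisfies \<open>H P = e \<cdot> \<nabla>g\<close>; hence at an inflection point the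
  whole tangent line is isotropic.
\<close>

lemma inflection_point_flex:
  fixes g :: "('a::field_char_0, 3) mvpoly"
  assumes infl: "inflection_point g P"
    and euler: "Var 1 * pd 1 g + Var 2 * pd 2 g + Var 3 * pd 3 g = of_nat (Suc e) * g"
  defines "n i \<equiv> eval P (pd i g)" and "H i j \<equiv> eval P (pd i (pd j g))"
  shows "H 2 2 * (n 3)\<^sup>2 - 2 * H 3 2 * n 2 * n 3 + H 3 3 * (n 2)\<^sup>2 = 0"
proof -
  from infl obtain Q where P: "P \<noteq> 0" "eval P g = 0" and Q: "\<And>c. Q \<noteq> c *s P"
    and nQ: "n 1 * Q $ 1 + n 2 * Q $ 2 + n 3 * Q $ 3 = 0"
    and dvd: "[:0, 1:] ^ 3 dvd subst (\<lambda>c. [:c:]) (\<lambda>i. [:P $ i, Q $ i:]) g"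
    unfolding inflection_point_def proj_zeros_def n_def by (auto simp: sum_3)
  have "coeff (subst (\<lambda>c. [:c:]) (\<lambda>i. [:P $ i, Q $ i:]) g) 2 = 0"
    using dvd monom_altdef[of "1::'a" 3] monom_1_dvd_iff'[of 3 "subst (\<lambda>c. [:c:]) (\<lambda>i. [:P $ i, Q $ i:]) g"]
    by simp
  then have "(\<Sum>i\<in>UNIV. \<Sum>j\<in>UNIV. Q $ i * Q $ j * H j i) = 0"
    using coeff_subst_line_2[OF coeff_id.coeff_ring_hom_axioms, of "\<lambda>i. P $ i" "\<lambda>i. Q $ i" g]
    by (simp add: H_def eval_def)
  moreover have sym: "H 1 2 = H 2 1" "H 1 3 = H 3 1" "H 2 3 = H 3 2"
    by (simp_all add: H_def pd_commute)
  ultimately have HQQ: "H 1 1 * Q $ 1 ^ 2 + H 2 2 * Q $ 2 ^ 2 + H 3 3 * Q $ 3 ^ 2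
      + 2 * H 2 1 * Q $ 1 * Q $ 2 + 2 * H 3 1 * Q $ 1 * Q $ 3 + 2 * H 3 2 * Q $ 2 * Q $ 3 = 0"
    by (simp add: sum_3 algebra_simps power2_eq_square)
  have nP: "n 1 * P $ 1 + n 2 * P $ 2 + n 3 * P $ 3 = 0"
    using arg_cong[OF euler, of "eval P"] P(2) by (simp add: n_def mult.commute)
  have HP: "P $ 1 * H 1 j + P $ 2 * H 2 j + P $ 3 * H 3 j = of_nat e * n j" for j
  proof -
    have "pd j (of_nat k * g) = of_nat k * pd j g" for k
      by (induction k) (simp_all add: algebra_simps)
    then have "pd j (Var 1 * pd 1 g + Var 2 * pd 2 g + Var 3 * pd 3 g) = of_nat (Suc e) * pd j g"
      unfolding euler by blast
    from arg_cong[OF this, of "eval P"] exhaust_3[of j] show ?thesis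
      by (auto simp: n_def H_def pd_commute algebra_simps)
  qed
  obtain c where c: "n 3 = c * (P $ 1 * Q $ 2 - Q $ 1 * P $ 2)" "- n 2 = c * (P $ 1 * Q $ 3 - Q $ 1 * P $ 3)"
    using orthogonal_to_independent[OF P(1) Q, of "vector [n 1, n 2, n 3]"] nP nQ by auto
  \<comment> \<open>Pairing H P = e n with P gives e (n . P) = 0; pairing it with Q in
    \<open>HPQ\<close> gives e (n . Q) = 0.\<close>
  have HPP: "H 1 1 * P $ 1 ^ 2 + H 2 2 * P $ 2 ^ 2 + H 3 3 * P $ 3 ^ 2
      + 2 * H 2 1 * P $ 1 * P $ 2 + 2 * H 3 1 * P $ 1 * P $ 3 + 2 * H 3 2 * P $ 2 * P $ 3 = 0"
    using HP[of 1] HP[of 2] HP[of 3] nP sym by algebra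
  have HPQ: "H 1 1 * P $ 1 * Q $ 1 + H 2 2 * P $ 2 * Q $ 2 + H 3 3 * P $ 3 * Q $ 3
      + H 2 1 * (P $ 1 * Q $ 2 + P $ 2 * Q $ 1) + H 3 1 * (P $ 1 * Q $ 3 + P $ 3 * Q $ 1)
      + H 3 2 * (P $ 2 * Q $ 3 + P $ 3 * Q $ 2) = 0"
    using HP[of 1] HP[of 2] HP[of 3] nQ sym by algebra
  \<comment> \<open>As (0, n 3, - n 2) = c (P_1 Q - Q_1 P), the quadratic form expands into its
    values on the pairs QQ, PQ and PP.\<close>
  have "H 2 2 * (n 3)\<^sup>2 + 2 * H 3 2 * (- n 2) * n 3 + H 3 3 * (- n 2)\<^sup>2 =
    c\<^sup>2 * ((P $ 1)\<^sup>2 * (H 1 1 * Q $ 1 ^ 2 + H 2 2 * Q $ 2 ^ 2 + H 3 3 * Q $ 3 ^ 2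
        + 2 * H 2 1 * Q $ 1 * Q $ 2 + 2 * H 3 1 * Q $ 1 * Q $ 3 + 2 * H 3 2 * Q $ 2 * Q $ 3)
      - 2 * P $ 1 * Q $ 1 * (H 1 1 * P $ 1 * Q $ 1 + H 2 2 * P $ 2 * Q $ 2 + H 3 3 * P $ 3 * Q $ 3
        + H 2 1 * (P $ 1 * Q $ 2 + P $ 2 * Q $ 1) + H 3 1 * (P $ 1 * Q $ 3 + P $ 3 * Q $ 1)
        + H 3 2 * (P $ 2 * Q $ 3 + P $ 3 * Q $ 2))
      + (Q $ 1)\<^sup>2 * (H 1 1 * P $ 1 ^ 2 + H 2 2 * P $ 2 ^ 2 + H 3 3 * P $ 3 ^ 2
        + 2 * H 2 1 * P $ 1 * P $ 2 + 2 * H 3 1 * P $ 1 * P $ 3 + 2 * H 3 2 * P $ 2 * P $ 3))"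
    unfolding c by algebra
  also have "\<dots> = 0" unfolding HPP HPQ HQQ by simp
  finally show ?thesis by simp
qed

section \<open>Smooth fibres and their flexes\<close>

lemma plane_section_simps [simp]:
  fixes p q :: "('a::comm_ring_1, 4) mvpoly"
  shows "plane_section (p + q) s t = plane_section p s t + plane_section q s t"
    "plane_section (p * q) s t = plane_section p s t * plane_section q s t"
    "plane_section (Const c :: ('a, 4) mvpoly) s t = Const c"
    "plane_section (of_nat n :: ('a, 4) mvpoly) s t = of_nat n"
    "plane_section (Var 1 :: ('a, 4) mvpoly) s t = Var 1" "plane_section (Var 2 :: ('a, 4) mvpoly) s t = Var 2"
    "plane_section (Var 3 :: ('a, 4) mvpoly) s t = Const s * Var 3"
    "plane_section (Var 4 :: ('a, 4) mvpoly) s t = Const t * Var 3"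
  by (simp_all add: plane_section_def)

lemma eval_plane_section [simp]:
  fixes p :: "('a::comm_ring_1, 4) mvpoly"
  shows "eval y (plane_section p s t) = eval (plane_point s t y) p"
proof (induction p rule: mvpoly_induct)
  case (Var i)
  have "\<forall>i. eval y (plane_section (Var i) s t) = eval (plane_point s t y) (Var i)"
    by (simp add: forall_4 plane_point_def)
  then show ?case by blast
qed simp_all

lemma pd_plane_section [simp]:
  fixes p :: "('a::comm_ring_1, 4) mvpoly"
  shows "pd 1 (plane_section p s t) = plane_section (pd 1 p) s t"
    "pd 2 (plane_section p s t) = plane_section (pd 2 p) s t"
    "pd 3 (plane_section p s t) = Const s * plane_section (pd 3 p) s t + Const t * plane_section (pd 4 p) s t"
  by (simp_all add: plane_section_def pd_subst sum_4 mult.commute)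

definition fibre :: "('a::comm_ring_1, 4) mvpoly \<Rightarrow> ('a, 4) mvpoly \<Rightarrow> 'a \<Rightarrow> 'a \<Rightarrow> ('a, 3) mvpoly" where
  "fibre p q s t = Const s * plane_section p s t + Const t * plane_section q s t"

lemma residual_curve_iff_fibre:
  fixes p q :: "('a::idom, 4) mvpoly"
  shows "residual_curve (Var 3 * p + Var 4 * q) s t g \<longleftrightarrow> g = fibre p q s t"
proof -
  have "plane_section (Var 3 * p + Var 4 * q) s t = Var 3 * fibre p q s t"
    by (simp add: fibre_def algebra_simps)
  then show ?thesis by (auto simp: residual_curve_def Var_neq_0)
qed

lemma eval_pd_fibre:
  fixes p q :: "('a::comm_ring_1, 4) mvpoly"
  assumes "x = plane_point s t y"
  shows "eval y (pd 1 (fibre p q s t)) = s * eval x (pd 1 p) + t * eval x (pd 1 q)"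
    "eval y (pd 2 (fibre p q s t)) = fib_2 (eval x) p q s t"
    "eval y (pd 3 (fibre p q s t)) = fib_3 (eval x) p q s t"
    "eval y (pd 2 (pd 2 (fibre p q s t))) = fib_22 (eval x) p q s t"
    "eval y (pd 3 (pd 2 (fibre p q s t))) = fib_23 (eval x) p q s t"
    "eval y (pd 3 (pd 3 (fibre p q s t))) = fib_33 (eval x) p q s t"
  using assms by (simp_all add: fibre_def fib_defs pd_commute algebra_simps)

lemma euler_fibre:
  fixes p q :: "('a::comm_ring_1, 4) mvpoly"
  assumes "homogeneous e p" "homogeneous e q"
  shows "Var 1 * pd 1 (fibre p q s t) + Var 2 * pd 2 (fibre p q s t) + Var 3 * pd 3 (fibre p q s t) =
    of_nat e * fibre p q s t"
proof -
  have *: "Var 1 * pd 1 (plane_section h s t) + Var 2 * pd 2 (plane_section h s t) + Var 3 * pd 3 (plane_section h s t) =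
    of_nat e * plane_section h s t" if "homogeneous e h" for h
    using arg_cong[OF euler_identity[OF that], of "\<lambda>g. plane_section g s t"]
    by (simp add: sum_4 algebra_simps)
  have "Var 1 * pd 1 (fibre p q s t) + Var 2 * pd 2 (fibre p q s t) + Var 3 * pd 3 (fibre p q s t) =
    Const s * (Var 1 * pd 1 (plane_section p s t) + Var 2 * pd 2 (plane_section p s t) + Var 3 * pd 3 (plane_section p s t)) +
    Const t * (Var 1 * pd 1 (plane_section q s t) + Var 2 * pd 2 (plane_section q s t) + Var 3 * pd 3 (plane_section q s t))"
    unfolding fibre_def by (simp only: pd_add pd_mult pd_Const mult_zero_left add_0_left) (simp only: algebra_simps)
  also have "\<dots> = of_nat e * fibre p q s t"
    unfolding *[OF assms(1)] *[OF assms(2)] fibre_def by (simp only: algebra_simps)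
  finally show ?thesis .
qed

lemma eval_flex_poly_flex_locus:
  fixes p q :: "('a::field_char_0, 4) mvpoly"
  assumes hom: "homogeneous (Suc e) p" "homogeneous (Suc e) q"
    and x: "x \<in> flex_locus (Var 3 * p + Var 4 * q)"
  shows "eval x (flex_poly p q) = 0"
proof -
  from x obtain s t P where st: "(s, t) \<noteq> (0, 0)" and x: "x = plane_point s t P"
    and infl: "inflection_point (fibre p q s t) P"
    unfolding flex_locus_def residual_curve_iff_fibre by blast
  have flex: "flex_form (eval x) p q s t = 0"
    using inflection_point_flex[OF infl euler_fibre[OF hom]] unfolding eval_pd_fibre[OF x]
    by (simp add: flex_form_def mult_ac)
  have "eval P (fibre p q s t) = 0"
    using infl by (simp add: inflection_point_def proj_zeros_def)
  then have 0: "s * eval x p + t * eval x q = 0" by (simp add: fibre_def x)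
  \<comment> \<open>The scalar c is 0 where p and q both vanish; scaling by \<open>c ^ 5\<close>
    covers this case as well.\<close>
  have "\<exists>c. eval x q = c * s \<and> - eval x p = c * t"
  proof (cases "s = 0")
    case False
    then show ?thesis using 0
      by (intro exI[of _ "eval x q / s"]) (simp add: field_simps add_eq_0_iff)
  next
    case True
    then show ?thesis using 0 st
      by (intro exI[of _ "- eval x p / t"]) simp
  qed
  then obtain c where "eval x q = c * s" "- eval x p = c * t" by blast
  then show ?thesis
    by (simp add: eval_flex_poly flex_form_scale flex)
qed

text \<open>
  Infinitely many singular fibres would give a singular point \<open>y\<close> of a fibre with transcendental
  parameter \<open>t\<close> over an ultrapower of the base field.  Differentiating the equation of the fibre
  along a derivation \<open>D\<close> with \<open>D t = 1\<close> kills the one partial derivative of \<open>f\<close> that does not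
  vanish for trivial reasons, so \<open>y\<close> comes from singular points of the surface.
\<close>

lemma finite_singular_fibres:
  fixes p q :: "('a::field_char_0, 4) mvpoly"
  defines "f \<equiv> Var 3 * p + Var 4 * q"
  assumes smooth: "smooth f"
  shows "finite {t. \<not> smooth (fibre p q 1 t)}"
proof (rule ccontr)
  assume "infinite {t. \<not> smooth (fibre p q 1 t)}"
  from infinite_countable_subset[OF this] obtain t :: "nat \<Rightarrow> 'a" where "inj t"
    and "range t \<subseteq> {t. \<not> smooth (fibre p q 1 t)}" by blast
  then have t: "\<not> smooth (fibre p q 1 (t n))" for n by auto
  have "\<exists>y. y \<noteq> 0 \<and> eval y (fibre p q 1 (t n)) = 0 \<and> (\<forall>i. eval y (pd i (fibre p q 1 (t n))) = 0)" for n
    using t[of n] by (auto simp: smooth_def proj_zeros_def)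
  then obtain y where y: "\<And>n. y n \<noteq> 0" and y0: "\<And>n. eval (y n) (fibre p q 1 (t n)) = 0"
    and yd: "\<And>n i. eval (y n) (pd i (fibre p q 1 (t n))) = 0" by metis
  define x where "x n = plane_point 1 (t n) (y n)" for n
  have x3: "x n $ 3 = y n $ 3" and x4: "x n $ 4 = t n * y n $ 3" for n
    by (simp_all add: x_def plane_point_def)
  have e0: "eval (x n) p + t n * eval (x n) q = 0" for n
    using y0[of n] by (simp add: fibre_def x_def)
  have e1: "eval (x n) (pd 1 p) + t n * eval (x n) (pd 1 q) = 0" for n
    using yd[of n 1] by (simp add: eval_pd_fibre[OF x_def])
  have e2: "eval (x n) (pd 2 p) + t n * eval (x n) (pd 2 q) = 0" for n
    using yd[of n 2] by (simp add: eval_pd_fibre[OF x_def] fib_defs)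
  have e3: "eval (x n) (pd 3 p) + t n * eval (x n) (pd 4 p) + t n * (eval (x n) (pd 3 q) + t n * eval (x n) (pd 4 q)) = 0" for n
    using yd[of n 3] by (simp add: eval_pd_fibre[OF x_def] fib_defs)
  define k :: "'a \<Rightarrow> 'a ultrapower" where "k c = ultra (\<lambda>_. c)" for c
  interpret k: coeff_ring_hom k
    by unfold_locales (simp_all add: k_def ultra_0 ultra_1 ultra_add ultra_mult)
  define T where "T = ultra t"
  define X where "X i = ultra (\<lambda>n. x n $ i)" for i
  define S where "S = subst k X"
  have S: "S h = ultra (\<lambda>n. eval (x n) h)" for h
    unfolding S_def
    by (induction h rule: mvpoly_induct) (simp_all add: k_def[symmetric] X_def[symmetric] ultra_add ultra_mult)
  \<comment> \<open>T is transcendental over K: otherwise infinitely many of the distinct values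
    \<open>t n\<close> would be roots of P.\<close>
  have "poly (map_poly k P) T \<noteq> 0" if "P \<noteq> 0" for P
  proof
    have "poly (map_poly k P) T = ultra (\<lambda>n. poly P (t n))"
      by (induction P) (simp_all add: map_poly_pCons k_def[symmetric] T_def ultra_add ultra_mult)
    moreover assume "poly (map_poly k P) T = 0"
    ultimately have "{n. poly P (t n) = 0} \<in> the_ultrafilter"
      using ultra_eq_iff[of "\<lambda>n. poly P (t n)" "\<lambda>_. 0"] by (simp add: ultra_0)
    then have "infinite (t -` {z. poly P z = 0})"
      using the_ultrafilter_infinite by (simp add: vimage_def)
    with poly_roots_finite[OF that] finite_vimageI[OF _ \<open>inj t\<close>] show False by blast
  qed
  from derivation_along_transcendental[OF k.coeff_ring_hom_axioms this, of "range X"]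
  obtain A D where D: "derivation_on A D" and A: "range k \<subseteq> A" "T \<in> A" "range X \<subseteq> A"
    and Dk: "\<And>c. D (k c) = 0" and DT: "D T = 1" by auto
  have SA: "S h \<in> A" for h
    unfolding S_def using A by (induction h rule: mvpoly_induct) (auto intro: derivation_on_closed[OF D])
  have DS: "D (S h) = (\<Sum>i\<in>UNIV. S (pd i h) * D (X i))" for h
    using derivation_chain_rule[OF k.coeff_hom_axioms, where E = "\<lambda>h. D (S h)" and v = X and p = h]
    by (simp add: S_def[symmetric] derivation_on_add[OF D] derivation_on_mult[OF D] SA Dk)
      (simp add: S_def derivation_on_add[OF D] derivation_on_mult[OF D] SA[unfolded S_def] Dk)
  \<comment> \<open>The equation of the plane. Differentiating it produces the extra summand X 3
    from D T = 1.\<close>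
  have "X 4 = T * X 3"
    by (simp add: X_def T_def x3 x4 flip: ultra_mult)
  then have DX4: "D (X 4) = X 3 + T * D (X 3)"
    using A by (simp add: derivation_on_mult[OF D] DT image_subset_iff)
  have E0: "S p + T * S q = 0"
    unfolding S T_def ultra_add[symmetric] ultra_mult[symmetric] e0 by (rule ultra_0)
  have E1: "S (pd 1 p) + T * S (pd 1 q) = 0"
    unfolding S T_def ultra_add[symmetric] ultra_mult[symmetric] e1 by (rule ultra_0)
  have E2: "S (pd 2 p) + T * S (pd 2 q) = 0"
    unfolding S T_def ultra_add[symmetric] ultra_mult[symmetric] e2 by (rule ultra_0)
  have E3: "S (pd 3 p) + T * S (pd 4 p) + T * (S (pd 3 q) + T * S (pd 4 q)) = 0"
    unfolding S T_def ultra_add[symmetric] ultra_mult[symmetric] e3 by (rule ultra_0)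
  have "D (S p + T * S q) = D (S p) + (S q + T * D (S q))"
    using A SA derivation_on_closed(6)[OF D A(2) SA[of q]]
    by (simp add: derivation_on_add[OF D] derivation_on_mult[OF D] DT)
  then have "D (S p) + (S q + T * D (S q)) = 0"
    by (simp add: E0 derivation_on_0[OF D])
  \<comment> \<open>The unknown values \<open>D (X i)\<close> are multiplied by the partial
    derivatives of the fibre, which vanish at the singular point. The contribution of D T remains,
    and it is \<open>pd 4 f\<close>.\<close>
  then have "(S (pd 1 p) + T * S (pd 1 q)) * D (X 1) + (S (pd 2 p) + T * S (pd 2 q)) * D (X 2) +
      (S (pd 3 p) + T * S (pd 4 p) + T * (S (pd 3 q) + T * S (pd 4 q))) * D (X 3) +
      (X 3 * S (pd 4 p) + S q + T * X 3 * S (pd 4 q)) = 0"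
    unfolding DS sum_4 DX4 by (simp add: algebra_simps)
  then have "X 3 * S (pd 4 p) + S q + T * X 3 * S (pd 4 q) = 0"
    unfolding E1 E2 E3 by simp
  moreover have "S (pd 4 f) = X 3 * S (pd 4 p) + S q + T * X 3 * S (pd 4 q)"
    using \<open>X 4 = T * X 3\<close> by (simp add: f_def S_def algebra_simps)
  ultimately have "ultra (\<lambda>n. eval (x n) (pd 4 f)) = ultra (\<lambda>_. 0)"
    by (simp add: S ultra_0)
  \<comment> \<open>A single index suffices; from here on the argument concerns one point over
    K.\<close>
  then have "{n. eval (x n) (pd 4 f) = 0} \<noteq> {}"
    unfolding ultra_eq_iff using the_ultrafilter_infinite by fastforce
  then obtain n where n: "eval (x n) (pd 4 f) = 0" by blast
  have "x n \<noteq> 0"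
    using y[of n] by (auto simp: vec_eq_iff forall_3 forall_4 x_def plane_point_def)
  moreover have "eval (x n) f = y n $ 3 * (eval (x n) p + t n * eval (x n) q)"
    by (simp add: f_def x3 x4 algebra_simps)
  moreover have "eval (x n) (pd 1 f) = y n $ 3 * (eval (x n) (pd 1 p) + t n * eval (x n) (pd 1 q))"
    by (simp add: f_def x3 x4 algebra_simps)
  moreover have "eval (x n) (pd 2 f) = y n $ 3 * (eval (x n) (pd 2 p) + t n * eval (x n) (pd 2 q))"
    by (simp add: f_def x3 x4 algebra_simps)
  \<comment> \<open>The right side is F + y_3 F_3 = 0 on the fibre, so \<open>pd 4 f = 0\<close>
    forces \<open>pd 3 f = 0\<close>.\<close>
  moreover have "eval (x n) (pd 3 f) + t n * eval (x n) (pd 4 f) =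
      (eval (x n) p + t n * eval (x n) q) +
      y n $ 3 * (eval (x n) (pd 3 p) + t n * eval (x n) (pd 4 p) + t n * (eval (x n) (pd 3 q) + t n * eval (x n) (pd 4 q)))"
    by (simp add: f_def x3 x4 algebra_simps)
  ultimately have "x n \<in> proj_zeros f" "\<forall>i. eval (x n) (pd i f) = 0"
    unfolding e0 e1 e2 e3 n by (simp_all add: proj_zeros_def forall_4 n)
  with smooth show False by (auto simp: smooth_def)
qed

text \<open>The point (0:1:0:0) is at infinity for \<open>line_poly\<close>; the value there is the
  coefficient in the full degree e.\<close>

lemma eval_line_eq_coeff:
  assumes "homogeneous e p"
  shows "eval (vector [0, 1, 0, 0]) p = coeff (line_poly p) e"
proof -
  let ?m = "Poly_Mapping.single (2::4) e"
  have "eval (vector [0, 1, 0, 0]) p = (\<Sum>m\<in>Poly_Mapping.keys p. if m = ?m then Poly_Mapping.lookup p m else 0)"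
    unfolding eval_def subst_def
  proof (rule sum.cong[OF refl])
    fix m assume "m \<in> Poly_Mapping.keys p"
    then have e: "Poly_Mapping.lookup m 1 + Poly_Mapping.lookup m 2 + Poly_Mapping.lookup m 3 + Poly_Mapping.lookup m 4 = e"
      using assms(1) by (simp add: homogeneous_def sum_4)
    have "m = ?m \<longleftrightarrow> Poly_Mapping.lookup m 1 = 0 \<and> Poly_Mapping.lookup m 3 = 0 \<and> Poly_Mapping.lookup m 4 = 0"
      using e by (auto simp: poly_mapping_eq_iff fun_eq_iff forall_4 lookup_single)
    then show "Poly_Mapping.lookup p m * (\<Prod>i\<in>UNIV. (vector [0, 1, 0, 0] :: 'a ^ 4) $ i ^ Poly_Mapping.lookup m i) =
      (if m = ?m then Poly_Mapping.lookup p m else 0)"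
      by (auto simp: prod_4 power_0_left)
  qed
  also have "\<dots> = coeff (line_poly p) e"
    using coeff_line_poly[OF assms order.refl] by (simp add: in_keys_iff)
  finally show ?thesis .
qed

lemma eval_eq_0_if_line_poly_eq_0:
  assumes "homogeneous e p" "line_poly p = 0" "x $ 3 = 0" "x $ 4 = 0"
  shows "eval x p = 0"
proof -
  have "Poly_Mapping.lookup p m * (\<Prod>i\<in>UNIV. x $ i ^ Poly_Mapping.lookup m i) = 0" for m
    using lookup_eq_0_if_line_poly_eq_0[OF assms(1,2), of m] assms(3,4) by (auto simp: prod_4 power_0_left)
  then show ?thesis unfolding eval_def subst_def by (intro sum.neutral) blast
qed

text \<open>At a root of a of order n, where b is nonzero, the left side of \<open>W\<close> has
  order n - 1 and the right side at least n.\<close>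

lemma degree_eq_0_if_wronskian_eq_0:
  fixes a b :: "'a::{alg_closed_field, field_char_0} poly"
  assumes W: "b * pderiv a = a * pderiv b" and coprime: "\<And>z. poly a z = 0 \<Longrightarrow> poly b z \<noteq> 0"
  shows "degree a = 0"
proof (rule ccontr)
  assume deg: "degree a \<noteq> 0"
  then obtain z where z: "poly a z = 0"
    using alg_closed_imp_poly_has_root[of a] by auto
  have a: "a \<noteq> 0" and a': "pderiv a \<noteq> 0" using deg by (auto simp: pderiv_eq_0_iff)
  have b: "poly b z \<noteq> 0" "b \<noteq> 0" using coprime[OF z] by auto
  have "order z b = 0" using b order_root by blast
  have nz: "b * pderiv a \<noteq> 0" using a' b by simp
  have "order z a \<noteq> 0" using z a order_root by blast
  have "order z (b * pderiv a) = order z (pderiv a)"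
    using order_mult[OF nz, of z] \<open>order z b = 0\<close> by simp
  moreover have "order z (a * pderiv b) = order z a + order z (pderiv b)"
    using order_mult nz W by metis
  moreover have "order z a = Suc (order z (pderiv a))"
    using order_pderiv[of a z] a z by simp
  ultimately show False using W by simp
qed

text \<open>On the line the gradient of the surface is (0, 0, p, q).\<close>

lemma smooth_on_line:
  fixes p q :: "('a::comm_ring_1, 4) mvpoly"
  assumes "smooth (Var 3 * p + Var 4 * q)" "x \<noteq> 0" "x $ 3 = 0" "x $ 4 = 0"
  shows "eval x p \<noteq> 0 \<or> eval x q \<noteq> 0"
proof (rule ccontr)
  assume "\<not> ?thesis"
  then have "\<forall>i. eval x (pd i (Var 3 * p + Var 4 * q)) = 0"
    using assms by (simp add: forall_4)
  moreover have "x \<in> proj_zeros (Var 3 * p + Var 4 * q)"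
    using assms by (simp add: proj_zeros_def)
  ultimately show False using assms(1) by (auto simp: smooth_def)
qed

text \<open>If the Wronskian vanishes, p and q are constant in the affine coordinate. Being forms of
  positive degree, they then have the common zero (0:1:0:0), against smoothness.\<close>

lemma wronskian_neq_0:
  fixes p q :: "('a::{alg_closed_field, field_char_0}, 4) mvpoly"
  assumes smooth: "smooth (Var 3 * p + Var 4 * q)"
    and hom: "homogeneous e p" "homogeneous e q" and "e > 0"
  shows "line_poly q * line_poly (pd 2 p) \<noteq> line_poly p * line_poly (pd 2 q)"
proof
  assume W: "line_poly q * line_poly (pd 2 p) = line_poly p * line_poly (pd 2 q)"
  have nz: "poly (line_poly p) y \<noteq> 0 \<or> poly (line_poly q) y \<noteq> 0" for y
    unfolding poly_line_poly by (rule smooth_on_line[OF smooth]) (simp_all add: vec_eq_iff forall_4)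
  have "degree (line_poly p) = 0" "degree (line_poly q) = 0"
    using degree_eq_0_if_wronskian_eq_0[of "line_poly q" "line_poly p"]
      degree_eq_0_if_wronskian_eq_0[of "line_poly p" "line_poly q"] W nz
    by (auto simp: pderiv_line_poly)
  then have "coeff (line_poly p) e = 0" "coeff (line_poly q) e = 0"
    using \<open>e > 0\<close> by (simp_all add: coeff_eq_0)
  then have "eval (vector [0, 1, 0, 0]) p = 0" "eval (vector [0, 1, 0, 0]) q = 0"
    using eval_line_eq_coeff hom by metis+
  with smooth_on_line[OF smooth, of "vector [0, 1, 0, 0]"] show False
    by (simp add: vec_eq_iff forall_4)
qed

text \<open>The second point on the tangent is Q = (0, F_3, -F_2), along which the second derivative
  of the fibre is the flex form. The Wronskian gives F_2 nonzero, so Q is no multiple of P, whose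
  third coordinate is 0.\<close>

lemma inflection_point_on_line:
  fixes p q :: "('a::field_char_0, 4) mvpoly"
  assumes flex: "line_poly (flex_poly p q) = 0"
    and b: "poly (line_poly q) y \<noteq> 0"
    and W: "poly (line_poly q * line_poly (pd 2 p) - line_poly p * line_poly (pd 2 q)) y \<noteq> 0"
    and t: "poly (line_poly p) y + t * poly (line_poly q) y = 0"
  shows "inflection_point (fibre p q 1 t) (vector [1, y, 0])"
proof -
  define P :: "'a ^ 3" where "P = vector [1, y, 0]"
  define x where "x = plane_point 1 t P"
  have x: "x = vector [1, y, 0, 0]" by (simp add: x_def P_def plane_point_def)
  note ev = poly_line_poly[of _ y, folded x]
  have bt: "eval x q * t = - eval x p"
    using t unfolding ev by (simp add: eq_neg_iff_add_eq_0 algebra_simps)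
  define n2 n3 where "n2 = fib_2 (eval x) p q 1 t" and "n3 = fib_3 (eval x) p q 1 t"
  have "eval x q * n2 = poly (line_poly q * line_poly (pd 2 p) - line_poly p * line_poly (pd 2 q)) y"
    using bt by (simp add: n2_def fib_2_def ev algebra_simps) (simp flip: mult.assoc)
  then have n2: "n2 \<noteq> 0" using W by auto
  have "flex_form (eval x) p q (eval x q * 1) (eval x q * t) = 0"
    using flex ev[of "flex_poly p q"] unfolding bt by (simp add: eval_flex_poly)
  then have ff: "flex_form (eval x) p q 1 t = 0"
    using b unfolding flex_form_scale ev by simp
  define Q :: "'a ^ 3" where "Q = vector [0, n3, - n2]"
  define g where "g = fibre p q 1 t"
  have g: "eval P g = 0" using t unfolding ev by (simp add: g_def fibre_def x_def)
  have n: "eval P (pd 2 g) = n2" "eval P (pd 3 g) = n3"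
    by (simp_all add: g_def n2_def n3_def eval_pd_fibre[OF x_def])
  have grad: "(\<Sum>i\<in>UNIV. eval P (pd i g) * Q $ i) = 0"
    by (simp add: sum_3 n Q_def mult.commute)
  let ?T = "subst (\<lambda>c. [:c:]) (\<lambda>i. [:P $ i, Q $ i:]) g"
  note tay = coeff_subst_line_0[OF coeff_id.coeff_ring_hom_axioms, of "\<lambda>i. P $ i" "\<lambda>i. Q $ i" g]
    coeff_subst_line_1[OF coeff_id.coeff_ring_hom_axioms, of "\<lambda>i. P $ i" "\<lambda>i. Q $ i" g]
    coeff_subst_line_2[OF coeff_id.coeff_ring_hom_axioms, of "\<lambda>i. P $ i" "\<lambda>i. Q $ i" g]
  have "coeff ?T 0 = 0" using tay(1) g by (simp add: eval_def)
  moreover have "coeff ?T 1 = 0" using tay(2) grad by (simp add: eval_def mult.commute)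
  moreover have "2 * coeff ?T 2 = flex_form (eval x) p q 1 t"
    unfolding tay(3) eval_def[symmetric]
    by (simp add: sum_3 Q_def g_def pd_commute[of 2 3] eval_pd_fibre[OF x_def] flex_form_def
        n2_def n3_def algebra_simps power2_eq_square)
  then have "coeff ?T 2 = 0" using ff by simp
  ultimately have "\<forall>k<3. coeff ?T k = 0"
    by (auto simp: less_Suc_eq numeral_3_eq_3 numeral_2_eq_2)
  then have "[:0, 1:] ^ 3 dvd ?T"
    using monom_altdef[of "1::'a" 3] monom_1_dvd_iff'[of 3 ?T] by simp
  moreover have "Q \<noteq> c *s P" for c
    using n2 by (auto simp: vec_eq_iff forall_3 Q_def P_def)
  moreover have "P \<in> proj_zeros g"
    using g by (auto simp: proj_zeros_def P_def vec_eq_iff forall_3)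
  ultimately show ?thesis
    using grad unfolding inflection_point_def P_def[symmetric] g_def[symmetric] by blast
qed

theorem proposition3p9:
  fixes f :: "('a::{alg_closed_field, field_char_0}, 4) mvpoly"
    and X :: "('a ^ 4) set"
    and d :: nat
  assumes "d \<ge> 4"
    and "homogeneous d f"
    and "X = proj_zeros f"
    and "vanishing_ideal X = range (\<lambda>g. f * g)"
    and "smooth f"
    and "line_l \<subseteq> X"
  shows "second_kind f \<longleftrightarrow> b0 d f = 0"
proof -
  have on_line: "(vector [1, y, 0, 0] :: 'a ^ 4) \<in> line_l" for y
    by (simp add: line_l_def vec_eq_iff forall_4)
  then have "line_poly f = 0"
    using assms(3,6) by (auto simp: line_poly_eq_0_iff proj_zeros_def)
  then obtain p q where f: "f = Var 3 * p + Var 4 * q"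
    and hom: "homogeneous (d - 1) p" "homogeneous (d - 1) q"
    using decompose_along_line assms(2) by blast
  note smooth = assms(5)[unfolded f]
  have W: "line_poly q * line_poly (pd 2 p) \<noteq> line_poly p * line_poly (pd 2 q)"
    using wronskian_neq_0[OF smooth hom] assms(1) by simp
  have "b0 d f = 0 \<longleftrightarrow> line_poly (flex_poly p q) = 0"
    by (rule b0_eq_0_iff[OF assms(1) f assms(2) hom W])
  moreover have "line_poly (flex_poly p q) = 0" if "second_kind f"
  proof -
    have d: "d - 1 = Suc (Suc (d - 3))" using assms(1) by simp
    \<comment> \<open>The flex form is one of the forms against which the closure is tested.\<close>
    obtain k where "homogeneous k (flex_poly p q)"
      using homogeneous_flex_poly hom unfolding d by blast
    moreover have "\<forall>x\<in>flex_locus f. eval x (flex_poly p q) = 0"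
      using eval_flex_poly_flex_locus hom unfolding d f by blast
    ultimately have "eval (vector [1, y, 0, 0]) (flex_poly p q) = 0" for y
      using that on_line[of y] unfolding second_kind_def proj_closure_def by blast
    then show ?thesis by (simp add: line_poly_eq_0_iff)
  qed
  moreover have "second_kind f" if flex: "line_poly (flex_poly p q) = 0"
    unfolding second_kind_def proj_closure_def
  proof (intro subsetI CollectI conjI allI impI)
    fix x :: "'a ^ 4" assume x: "x \<in> line_l"
    then show "x \<noteq> 0" by (simp add: line_l_def)
    fix e g assume g: "homogeneous e g" and g0: "\<forall>z\<in>flex_locus f. eval z g = 0"
    define w where "w = line_poly q * line_poly (pd 2 p) - line_poly p * line_poly (pd 2 q)"
    define S where "S = {t. \<not> smooth (fibre p q 1 t)}"
    \<comment> \<open>Excluded are the points where t = -p/q is undefined, those where the Wronskian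
      vanishes, and those on singular fibres.\<close>
    define Z where "Z = {y. poly (line_poly q) y = 0} \<union> {y. poly w y = 0} \<union>
      (\<Union>t\<in>S. {y. poly (line_poly p + smult t (line_poly q)) y = 0})"
    have "w \<noteq> 0" using W by (simp add: w_def)
    have "line_poly q \<noteq> 0"
      using W pderiv_line_poly[of q] by auto
    \<comment> \<open>Otherwise p and q would be proportional on the line and their Wronskian zero.
      Hence a singular fibre meets the line in finitely many affine points.\<close>
    have "line_poly p + smult t (line_poly q) \<noteq> 0" for t
    proof
      assume "line_poly p + smult t (line_poly q) = 0"
      then have "line_poly p = smult (- t) (line_poly q)" by (simp add: eq_neg_iff_add_eq_0)
      moreover from this have "line_poly (pd 2 p) = smult (- t) (line_poly (pd 2 q))"
        by (simp add: pderiv_line_poly[symmetric] pderiv_smult pderiv_minus)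
      ultimately show False using W by simp
    qed
    moreover have "finite S" unfolding S_def by (rule finite_singular_fibres[OF smooth])
    ultimately have fin: "finite Z"
      unfolding Z_def using \<open>w \<noteq> 0\<close> \<open>line_poly q \<noteq> 0\<close> by (intro finite_UnI finite_UN_I poly_roots_finite)
    have "poly (line_poly g) y = 0" if "y \<notin> Z" for y
    proof -
      have b: "poly (line_poly q) y \<noteq> 0" and w: "poly w y \<noteq> 0" using that by (auto simp: Z_def)
      define t where "t = - poly (line_poly p) y / poly (line_poly q) y"
      have t: "poly (line_poly p) y + t * poly (line_poly q) y = 0" using b by (simp add: t_def)
      then have "t \<notin> S" using that by (auto simp: Z_def)
      then have sm: "smooth (fibre p q 1 t)" by (simp add: S_def)
      have infl: "inflection_point (fibre p q 1 t) (vector [1, y, 0])"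
        by (rule inflection_point_on_line[OF flex b w[unfolded w_def] t])
      have "plane_point 1 t (vector [1, y, 0]) \<in> flex_locus f"
        unfolding flex_locus_def f residual_curve_iff_fibre using sm infl
        by (intro CollectI exI[of _ "1::'a"] exI[of _ t] exI[of _ "fibre p q 1 t"] exI[of _ "vector [1, y, 0]"]) simp
      then have "vector [1, y, 0, 0] \<in> flex_locus f" by (simp add: plane_point_def)
      then show ?thesis using g0 by (simp add: poly_line_poly)
    qed
    then have "- Z \<subseteq> {y. poly (line_poly g) y = 0}" by blast
    moreover have "infinite (- Z)"
      using fin infinite_UNIV_char_0 finite_compl by blast
    ultimately have "line_poly g = 0"
      using poly_roots_finite finite_subset by metis
    \<comment> \<open>Homogeneity carries the vanishing from the points (1:y:0:0) to the whole line,
      including (0:1:0:0).\<close>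
    then show "eval x g = 0"
      using eval_eq_0_if_line_poly_eq_0[OF g] x by (simp add: line_l_def)
  qed
  ultimately show ?thesis by blast
qed

end
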